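(* Let $\mu \in \mathcal{M}$, and consider the function $h : (0,\infty) \times \mathbb{C}^+ \to \mathbb{C}$ defined by $$h(t,z) = F_{\mathbb{B}_t(\mu)}(z) - z, \qquad \forall\, t>0,\ \forall\, z \in \mathbb{C}^+ .$$ Then $h$ satisfies the complex Burgers equation $$\frac{\partial h}{\partial t}(t,z) = h(t,z)\, \frac{\partial h}{\partial z}(t,z), \qquad t>0,\ z \in \mathbb{C}^+ .$$
   Context: $\mathcal{M}$ is the set of Borel probability measures on $\mathbb{R}$; $\mathbb{C}^+$ is the open upper half-plane. For $\mu \in \mathcal{M}$: $G_\mu(z) = \int_{\mathbb{R}} \frac{d\mu(s)}{z-s}$ is the Cauchy transform and $F_\mu(z) = 1/G_\mu(z)$ the reciprocal Cauchy transform; $F_\mu$ is an analytic self-map of $\mathbb{C}^+$. For every $\alpha>0$ there is $\beta>0$ such that $F_\mu$ has an analytic right inverse $F_\mu^{-1}$ on $\Gamma_{\alpha,\beta}=\{z\in\mathbb{C}^+ : |\Re z|<\alpha\,\Im z,\ \Im z>\beta\}$ with $F_\mu^{-1}(z)/z\to 1$ as $z\to\infty$ in $\Gamma_{\alpha,\beta}$; put $V_\mu(z) = F_\mu^{-1}(z)-z$ there. For $t\ge 1$, the free additive convolution power $\mu^{\boxplus t}\in\mathcal{M}$ is the unique probability measure with $V_{\mu^{\boxplus t}} = tV_\mu$ on a common truncated cone (it is known to exist). For $t>0$, the Boolean convolution power $\mu^{\uplus t}\in\mathcal{M}$ is the unique probability measure with $F_{\mu^{\uplus t}}(z) = tF_\mu(z)+(1-t)z$,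 $z\in\mathbb{C}^+$ (it always exists). For $t\ge0$, $\mathbb{B}_t(\mu) = \bigl( \mu^{\boxplus(1+t)} \bigr)^{\uplus(1/(1+t))}$. *)

theory Defs
  imports "HOL-Probability.Probability" "HOL-Complex_Analysis.Complex_Analysis"
begin

definition upper_half_plane :: "complex set" where
  "upper_half_plane = {z. Im z > 0}"

definition cauchy_transform :: "real measure \<Rightarrow> complex \<Rightarrow> complex" where
  "cauchy_transform \<mu> z = (LINT s|\<mu>. 1 / (z - complex_of_real s))"

definition recip_cauchy_transform :: "real measure \<Rightarrow> complex \<Rightarrow> complex" where
  "recip_cauchy_transform \<mu> z = 1 / cauchy_transform \<mu> z"

definition truncated_cone :: "real \<Rightarrow> real \<Rightarrow> complex set" where
  "truncated_cone \<alpha> \<beta> = {z \<in> upper_half_plane. \<bar>Re z\<bar> < \<alpha> * Im z \<and> Im z > \<beta>}"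

text \<open>The inverse takes values in the upper half-plane, the domain of the reciprocal
  Cauchy transform; this has to be demanded, since the integral also makes sense elsewhere.
  The filter below describes \<open>z\<close> tending to infinity inside the cone.\<close>

definition is_right_inverse_on_cone ::
    "real measure \<Rightarrow> real \<Rightarrow> real \<Rightarrow> (complex \<Rightarrow> complex) \<Rightarrow> bool" where
  "is_right_inverse_on_cone \<mu> \<alpha> \<beta> \<Phi> \<longleftrightarrow>
     \<Phi> analytic_on truncated_cone \<alpha> \<beta> \<and>
     (\<forall>z\<in>truncated_cone \<alpha> \<beta>. \<Phi> z \<in> upper_half_plane \<and> recip_cauchy_transform \<mu> (\<Phi> z) = z) \<and>
     ((\<lambda>z. \<Phi> z / z) \<longlongrightarrow> 1) (inf at_infinity (principal (truncated_cone \<alpha> \<beta>)))"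

text \<open>A right inverse with this behaviour at infinity is unique on its cone, so the values of
  \<open>V\<close> on the cone are determined by the measure; values elsewhere are irrelevant.\<close>

definition is_voiculescu_transform_on_cone ::
    "real measure \<Rightarrow> real \<Rightarrow> real \<Rightarrow> (complex \<Rightarrow> complex) \<Rightarrow> bool" where
  "is_voiculescu_transform_on_cone \<mu> \<alpha> \<beta> V \<longleftrightarrow>
     (\<exists>\<Phi>. is_right_inverse_on_cone \<mu> \<alpha> \<beta> \<Phi> \<and> (\<forall>z\<in>truncated_cone \<alpha> \<beta>. V z = \<Phi> z - z))"

text \<open>Meaningful for \<open>t \<ge> 1\<close>.\<close>

definition free_power :: "real measure \<Rightarrow> real \<Rightarrow> real measure" where
  "free_power \<mu> t = (THE \<nu>. real_distribution \<nu> \<and>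
     (\<exists>\<alpha>>0. \<exists>\<beta>>0. \<exists>V.
        is_voiculescu_transform_on_cone \<mu> \<alpha> \<beta> V \<and>
        is_voiculescu_transform_on_cone \<nu> \<alpha> \<beta> (\<lambda>z. complex_of_real t * V z)))"

text \<open>Meaningful for \<open>t > 0\<close>.\<close>

definition boolean_power :: "real measure \<Rightarrow> real \<Rightarrow> real measure" where
  "boolean_power \<mu> t = (THE \<nu>. real_distribution \<nu> \<and>
     (\<forall>z\<in>upper_half_plane. recip_cauchy_transform \<nu> z =
        complex_of_real t * recip_cauchy_transform \<mu> z + complex_of_real (1 - t) * z))"

definition free_boolean_map :: "real \<Rightarrow> real measure \<Rightarrow> real measure" where
  "free_boolean_map t \<mu> = boolean_power (free_power \<mu> (1 + t)) (1 / (1 + t))"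

end

theory Submission
  imports Defs
begin

text \<open>Write \<open>g(z) = F(z) - z\<close> for the reciprocal Cauchy transform \<open>F\<close> of the given measure; \<open>g\<close> maps the upper
  half-plane into its closure and \<open>g(iy) = o(y)\<close>. By the Schwarz--Pick inequality, \<open>w - t g(w)\<close> is
  injective on the set where its imaginary part is positive and maps it onto the upper half-plane;
  its inverse is the subordination function \<open>\<omega>\<^sub>t\<close>, so that \<open>\<omega>\<^sub>t(z) = z + t g(\<omega>\<^sub>t(z))\<close>. The free power of
  exponent \<open>1 + t\<close> has reciprocal Cauchy transform \<open>F \<circ> \<omega>\<^sub>t\<close>, and passing to the Boolean power gives
  \<open>h(t, z) = g(\<omega>\<^sub>t(z))\<close>. The defining equation of \<open>\<omega>\<close> yields the method of characteristics,
  \<open>h(s, z) = h(t, z + (s - t) h(s, z))\<close>, and differentiating this at \<open>s = t\<close> gives the Burgers equation.\<close>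

section \<open>The Schwarz--Pick inequality\<close>

text \<open>Both convolution powers are definite descriptions over measures, so using them takes
  existence and uniqueness of a measure with prescribed transform. Existence is a Stieltjes
  representation: every function of the class \<open>pick_perturbation\<close> is
  \<open>F(z) - z\<close> for some probability measure, and the class is stable under subordination,
  so one construction serves both powers. For uniqueness, inverses on unrelated cones are compared
  on the imaginary axis, which every cone contains near infinity. The quantitative work rests on the
  right-hand side of Schwarz--Pick being a product \<open>Im (g a) * Im (g b)\<close>: if g is small
  at one well-chosen point, it is controlled at every other point. In the Burgers step nothing is
  known at first about how h depends on t. The characteristic identity moves this dependence into
  the space variable, where h is holomorphic, and local boundedness in s is enough to start the
  argument.\<close>

lemma mem_upper_half_plane [simp]: "z \<in> upper_half_plane \<longleftrightarrow> Im z > 0"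
  by (simp add: upper_half_plane_def)

lemma open_upper_half_plane: "open upper_half_plane"
  by (simp add: upper_half_plane_def open_halfspace_Im_gt)

lemma convex_upper_half_plane: "convex upper_half_plane"
  by (simp add: upper_half_plane_def convex_halfspace_Im_gt)

lemma cmod_diff_cnj_power2:
  "(cmod (z - cnj p))\<^sup>2 = (cmod (z - p))\<^sup>2 + 4 * Im z * Im p"
  by (simp only: cmod_power2) (simp add: power2_eq_square algebra_simps)

text \<open>The Cayley transforms \<open>C p\<close> carry the half-plane to the disc with p at the
  origin, so the Schwarz lemma applies to the conjugated map. The squared pseudohyperbolic distance
  is X / (X + 4 P), which reduces the comparison to X * Q \<le> Y * P. The division-free form also
  makes sense when imaginary parts of values vanish.\<close>

lemma Schwarz_Pick_strict:
  assumes holf: "f holomorphic_on upper_half_plane"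
    and pos: "\<And>z. Im z > 0 \<Longrightarrow> Im (f z) > 0"
    and a: "Im a > 0" and b: "Im b > 0"
  shows "(cmod (f a - f b))\<^sup>2 * (Im a * Im b) \<le> (cmod (a - b))\<^sup>2 * (Im (f a) * Im (f b))"
proof -
  define C where "C = (\<lambda>p z::complex. (z - p) / (z - cnj p))"
  \<comment> \<open>Inverse of the Cayley transform \<open>C b\<close>; it maps the unit disc into
    the half-plane and 0 to b.\<close>
  define D where "D = (\<lambda>w. (b - cnj b * w) / (1 - w))"
  have nz: "z - cnj p \<noteq> 0" if "Im z > 0" "Im p > 0" for z p
    using that by (metis add_pos_pos cnj.simps(2) diff_minus_eq_add less_irrefl minus_complex.simps(2) zero_complex.simps(2))
  have C2: "(cmod (C p z))\<^sup>2 = (cmod (z - p))\<^sup>2 / ((cmod (z - p))\<^sup>2 + 4 * Im z * Im p)" for p z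
    by (simp add: C_def norm_divide power_divide cmod_diff_cnj_power2)
  have C_less: "cmod (C p z) < 1" if "Im z > 0" "Im p > 0" for p z
  proof -
    have "(cmod (C p z))\<^sup>2 < 1"
      unfolding C2 using that by (subst divide_less_eq_1_pos) (auto intro: add_nonneg_pos)
    then show ?thesis by (simp add: power_less_one_iff)
  qed
  have D_pos: "Im (D w) > 0" if "cmod w < 1" for w
  proof -
    have "w \<noteq> 1" using that by auto
    have "(cmod w)\<^sup>2 < 1" using that by (simp add: power_less_one_iff)
    have "Im ((b - cnj b * w) * cnj (1 - w)) = Im b * (1 - (cmod w)\<^sup>2)"
      by (simp only: cmod_power2) (simp add: power2_eq_square algebra_simps)
    moreover have "Im (D w) = Im ((b - cnj b * w) * cnj (1 - w)) / (cmod (1 - w))\<^sup>2"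
      unfolding D_def by (subst complex_div_cnj) (simp del: complex_cnj_diff of_real_power add: of_real_power[symmetric])
    ultimately show ?thesis
      using b \<open>(cmod w)\<^sup>2 < 1\<close> \<open>w \<noteq> 1\<close> by simp
  qed
  have DC: "D (C b z) = z" if "Im z > 0" for z
  proof -
    have "1 - C b z = (b - cnj b) / (z - cnj b)" "b - cnj b * C b z = z * (b - cnj b) / (z - cnj b)"
      using nz[OF that b] by (simp_all add: C_def field_simps)
    moreover have "b - cnj b \<noteq> 0" using nz[OF b b] .
    ultimately show ?thesis using nz[OF that b] by (simp add: D_def)
  qed
  define \<phi> where "\<phi> = (\<lambda>w. C (f b) (f (D w)))"
  have fb: "Im (f b) > 0" using pos b by simp
  have Dhol: "D holomorphic_on ball 0 1"
    unfolding D_def by (intro holomorphic_intros) auto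
  have "(f \<circ> D) holomorphic_on ball 0 1"
    by (rule holomorphic_on_compose_gen[OF Dhol holf]) (auto intro: D_pos)
  then have "\<phi> holomorphic_on ball 0 1"
    unfolding \<phi>_def C_def o_def
    by (intro holomorphic_intros) (use nz pos D_pos fb in auto)
  moreover have "\<phi> 0 = 0" by (simp add: \<phi>_def C_def D_def)
  moreover have "cmod (\<phi> w) < 1" if "cmod w < 1" for w
    using C_less D_pos[OF that] pos fb by (simp add: \<phi>_def)
  ultimately have "cmod (\<phi> (C b a)) \<le> cmod (C b a)"
    using Schwarz_Lemma(1)[of \<phi> "C b a"] C_less[OF a b] by blast
  then have "(cmod (C (f b) (f a)))\<^sup>2 \<le> (cmod (C b a))\<^sup>2"
    unfolding \<phi>_def DC[OF a] by (simp add: power_mono)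
  then show ?thesis
    unfolding C2
  proof -
    define X Y P Q where defs: "X = (cmod (f a - f b))\<^sup>2" "Y = (cmod (a - b))\<^sup>2"
      "P = Im (f a) * Im (f b)" "Q = Im a * Im b"
    have "P > 0" "Q > 0" "X \<ge> 0" "Y \<ge> 0" using a b fb pos[OF a] by (auto simp: defs)
    assume "(cmod (f a - f b))\<^sup>2 / ((cmod (f a - f b))\<^sup>2 + 4 * Im (f a) * Im (f b))
        \<le> (cmod (a - b))\<^sup>2 / ((cmod (a - b))\<^sup>2 + 4 * Im a * Im b)"
    then have "X / (X + 4 * P) \<le> Y / (Y + 4 * Q)" by (simp add: defs mult.assoc)
    then have "X * (Y + 4 * Q) \<le> Y * (X + 4 * P)"
      using \<open>P > 0\<close> \<open>Q > 0\<close> \<open>X \<ge> 0\<close> \<open>Y \<ge> 0\<close> by (simp add: divide_simps add_nonneg_pos split: if_splits)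
    then have "X * Q \<le> Y * P" by (simp add: algebra_simps)
    then show ?thesis by (simp add: defs)
  qed
qed

text \<open>Values on the real line must be allowed: for a point mass, \<open>F(z) - z\<close> is a
  real constant. Adding \<open>\<i> * e\<close> to f returns to the strict case, and both sides are
  continuous in e.\<close>

lemma Schwarz_Pick:
  assumes holf: "f holomorphic_on upper_half_plane"
    and nonneg: "\<And>z. Im z > 0 \<Longrightarrow> Im (f z) \<ge> 0"
    and a: "Im a > 0" and b: "Im b > 0"
  shows "(cmod (f a - f b))\<^sup>2 * (Im a * Im b) \<le> (cmod (a - b))\<^sup>2 * (Im (f a) * Im (f b))"
proof (rule tendsto_lowerbound)
  show "((\<lambda>e. (cmod (a - b))\<^sup>2 * ((Im (f a) + e) * (Im (f b) + e))) \<longlongrightarrow>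
      (cmod (a - b))\<^sup>2 * (Im (f a) * Im (f b))) (at_right 0)"
    by (auto intro!: tendsto_eq_intros)
  have "(cmod (f a - f b))\<^sup>2 * (Im a * Im b) \<le> (cmod (a - b))\<^sup>2 * ((Im (f a) + e) * (Im (f b) + e))"
    if "e > 0" for e
  proof -
    have "(\<lambda>z. f z + \<i> * of_real e) holomorphic_on upper_half_plane"
      by (intro holomorphic_intros holf)
    from Schwarz_Pick_strict[OF this _ a b] show ?thesis
      using that nonneg by (simp add: add_nonneg_pos)
  qed
  then show "\<forall>\<^sub>F e in at_right 0. (cmod (f a - f b))\<^sup>2 * (Im a * Im b)
      \<le> (cmod (a - b))\<^sup>2 * ((Im (f a) + e) * (Im (f b) + e))"
    by (auto simp: eventually_at_filter)
qed simp

section \<open>Subordination functions\<close>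

text \<open>These are the Nevanlinna functions without linear term. They turn out to be exactly the
  functions \<open>F(z) - z\<close> of probability measures: one direction is the
  \<open>sublocale\<close> of \<open>real_distribution\<close>, the other is
  \<open>representing_measure_exists\<close>.\<close>

locale pick_perturbation =
  fixes g :: "complex \<Rightarrow> complex"
  assumes holomorphic: "g holomorphic_on upper_half_plane"
    and Im_nonneg: "Im z > 0 \<Longrightarrow> Im (g z) \<ge> 0"
    and vertical_limit: "((\<lambda>y. g (\<i> * complex_of_real y) / complex_of_real y) \<longlongrightarrow> 0) at_top"
begin

lemma small_on_imaginary_axis:
  assumes "e > 0"
  shows "\<forall>\<^sub>F y in at_top. y > 0 \<and> cmod (g (\<i> * complex_of_real y)) \<le> e * y"
proof -
  have "\<forall>\<^sub>F y in at_top. cmod (g (\<i> * complex_of_real y) / complex_of_real y) < e"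
    using tendstoD[OF vertical_limit assms] by (simp add: dist_norm)
  with eventually_gt_at_top[of "0::real"] show ?thesis
    by eventually_elim (simp add: norm_divide divide_simps)
qed

text \<open>Only the product of the two imaginary parts enters, so a strong bound at one point can
  make up for a weak bound at the other.\<close>

lemma lipschitz_bound:
  assumes "Im a > 0" "Im b > 0" "c \<ge> 0" "Im (g a) * Im (g b) \<le> c\<^sup>2 * (Im a * Im b)"
  shows "cmod (g a - g b) \<le> c * cmod (a - b)"
proof -
  have "(cmod (g a - g b))\<^sup>2 * (Im a * Im b) \<le> (cmod (a - b))\<^sup>2 * (Im (g a) * Im (g b))"
    using Schwarz_Pick[OF holomorphic Im_nonneg] assms by blast
  also have "\<dots> \<le> (cmod (a - b))\<^sup>2 * (c\<^sup>2 * (Im a * Im b))"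
    using assms by (intro mult_left_mono) auto
  finally have "(cmod (g a - g b))\<^sup>2 * (Im a * Im b) \<le> (c * cmod (a - b))\<^sup>2 * (Im a * Im b)"
    by (simp add: power_mult_distrib mult_ac)
  then have "(cmod (g a - g b))\<^sup>2 \<le> (c * cmod (a - b))\<^sup>2"
    using assms by (simp add: mult_le_cancel_right_pos)
  then show ?thesis
    using \<open>c \<ge> 0\<close> by (simp add: abs_le_square_iff[symmetric])
qed

text \<open>Two preimages satisfy \<open>t * (g a - g b) = a - b\<close>, which forces near-equality
  in Schwarz--Pick; but a shift with positive imaginary part means
  \<open>t * Im (g w) < Im w\<close>, and this makes the inequality strict.\<close>

lemma shift_injective:
  assumes "t > 0" "Im a > 0" "Im b > 0"
    and "Im (a - of_real t * g a) > 0" and eq: "a - of_real t * g a = b - of_real t * g b"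
  shows "a = b"
proof (rule ccontr)
  assume "a \<noteq> b"
  have "t * Im (g a) < Im a" using assms(4) by simp
  have "Im (b - of_real t * g b) > 0" using assms(4,5) by simp
  then have "t * Im (g b) < Im b" by simp
  have "of_real t * (g a - g b) = a - b" using eq by (simp add: algebra_simps)
  then have ab: "t * cmod (g a - g b) = cmod (a - b)"
    by (metis abs_of_pos assms(1) norm_mult norm_of_real)
  have "(cmod (a - b))\<^sup>2 * (Im a * Im b) = t\<^sup>2 * ((cmod (g a - g b))\<^sup>2 * (Im a * Im b))"
    unfolding ab[symmetric] by (simp add: power_mult_distrib)
  also have "\<dots> \<le> t\<^sup>2 * ((cmod (a - b))\<^sup>2 * (Im (g a) * Im (g b)))"
    using Schwarz_Pick[OF holomorphic Im_nonneg] assms by (intro mult_left_mono) auto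
  also have "\<dots> = (cmod (a - b))\<^sup>2 * ((t * Im (g a)) * (t * Im (g b)))"
    by (simp add: power2_eq_square)
  also have "\<dots> < (cmod (a - b))\<^sup>2 * (Im a * Im b)"
  proof (rule mult_strict_left_mono)
    show "(t * Im (g a)) * (t * Im (g b)) < Im a * Im b"
      using \<open>t * Im (g a) < Im a\<close> \<open>t * Im (g b) < Im b\<close> assms Im_nonneg
      by (intro mult_strict_mono) auto
  qed (use \<open>a \<noteq> b\<close> in simp)
  finally show False by simp
qed

text \<open>The point b is an anchor where g is small. Since w has a shift in the half-plane,
  \<open>t * Im (g w) < Im w\<close>; with the factor 1/4 at b, \<open>t * g\<close> contracts
  distances to b by 1/2 = sqrt (1/4). The second bound says that the shift is proper, uniformly for
  t up to T.\<close>

lemma shift_preimage_bound: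
  assumes "0 < t" "t \<le> T" "Im w > 0" "Im (w - of_real t * g w) > 0"
    and b: "Im b > 0" "T * Im (g b) \<le> Im b / 4"
  shows "t * cmod (g w - g b) \<le> cmod (w - b) / 2"
    and "cmod w \<le> 2 * cmod (w - of_real t * g w) + 2 * T * cmod (g b) + cmod b"
proof -
  have "t * Im (g w) * (t * Im (g b)) \<le> Im w * (Im b / 4)"
  proof (rule mult_mono)
    have "t * Im (g b) \<le> T * Im (g b)"
      using assms Im_nonneg by (intro mult_right_mono) auto
    then show "t * Im (g b) \<le> Im b / 4" using assms by linarith
  qed (use assms Im_nonneg in auto)
  then have "Im (g w) * Im (g b) \<le> (1 / (2 * t))\<^sup>2 * (Im w * Im b)"
    using \<open>0 < t\<close> by (simp add: field_simps power2_eq_square)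
  then have "cmod (g w - g b) \<le> 1 / (2 * t) * cmod (w - b)"
    using assms by (intro lipschitz_bound) auto
  then show *: "t * cmod (g w - g b) \<le> cmod (w - b) / 2"
    using \<open>0 < t\<close> by (simp add: field_simps)
  have "cmod w \<le> cmod (w - of_real t * g w) + cmod (of_real t * g w)"
    by (metis diff_add_cancel norm_triangle_ineq)
  moreover have "cmod (of_real t * g w) = t * cmod (g w)"
    using \<open>0 < t\<close> by (simp add: norm_mult)
  moreover have "t * cmod (g w) \<le> t * (cmod (g w - g b) + cmod (g b))"
    using \<open>0 < t\<close> by (intro mult_left_mono) (auto simp: norm_triangle_sub add.commute)
  moreover have "t * cmod (g b) \<le> T * cmod (g b)"
    using assms by (intro mult_right_mono) auto
  moreover have "cmod (w - b) \<le> cmod w + cmod b"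
    by (rule norm_triangle_ineq4)
  ultimately show "cmod w \<le> 2 * cmod (w - of_real t * g w) + 2 * T * cmod (g b) + cmod b"
    using * by (simp add: distrib_left)
qed

lemma anchor_exists:
  assumes "T > 0"
  obtains b where "Im b > 0" "T * Im (g b) \<le> Im b / 4"
proof -
  have "\<forall>\<^sub>F y in at_top. y > 0 \<and> cmod (g (\<i> * complex_of_real y)) \<le> 1 / (4 * T) * y"
    using assms by (intro small_on_imaginary_axis) simp
  then obtain y where y: "y > 0" "cmod (g (\<i> * complex_of_real y)) \<le> 1 / (4 * T) * y"
    using eventually_happens'[OF trivial_limit_at_top_linorder] by blast
  then have "Im (g (\<i> * complex_of_real y)) \<le> 1 / (4 * T) * y"
    using abs_Im_le_cmod[of "g (\<i> * complex_of_real y)"] by linarith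
  then show ?thesis
    using that[of "\<i> * of_real y"] y(1) assms by (simp add: field_simps)
qed

definition shift_domain :: "real \<Rightarrow> complex set" where
  "shift_domain t = {w. Im w > 0 \<and> Im (w - of_real t * g w) > 0}"

lemma shift_holomorphic: "(\<lambda>w. w - of_real t * g w) holomorphic_on upper_half_plane"
  by (intro holomorphic_intros holomorphic)

lemma shift_domain_subset: "shift_domain t \<subseteq> upper_half_plane"
  by (auto simp: shift_domain_def)

lemma open_shift_domain: "open (shift_domain t)"
proof -
  have "shift_domain t = upper_half_plane \<inter> (\<lambda>w. w - of_real t * g w) -` upper_half_plane"
    by (auto simp: shift_domain_def)
  then show ?thesis
    using continuous_open_preimage[OF holomorphic_on_imp_continuous_on[OF shift_holomorphic]
        open_upper_half_plane open_upper_half_plane] by simp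
qed

lemma inj_on_shift: "t > 0 \<Longrightarrow> inj_on (\<lambda>w. w - of_real t * g w) (shift_domain t)"
  by (rule inj_onI) (rule shift_injective, auto simp: shift_domain_def)

text \<open>The image is open by the open mapping theorem and relatively closed by properness, hence
  everything by connectedness.\<close>

lemma shift_image:
  assumes "t > 0"
  shows "(\<lambda>w. w - of_real t * g w) ` shift_domain t = upper_half_plane" (is "?f ` _ = _")
proof -
  let ?S = "?f ` shift_domain t"
  have sub: "?S \<subseteq> upper_half_plane"
    by (auto simp: shift_domain_def)
  obtain b where b: "Im b > 0" "t * Im (g b) \<le> Im b / 4"
    using anchor_exists[OF assms] .
  have "open ?S"
    by (rule open_mapping_thm3[OF holomorphic_on_subset[OF shift_holomorphic shift_domain_subset]
          open_shift_domain inj_on_shift[OF assms]])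
  then have op: "openin (top_of_set upper_half_plane) ?S"
    using sub by (simp add: open_subset)
  have cl: "closedin (top_of_set upper_half_plane) ?S"
    unfolding closedin_limpt
  proof (intro conjI allI impI sub; elim conjE)
    fix x assume "x islimpt ?S" and x: "x \<in> upper_half_plane"
    then obtain \<zeta> where \<zeta>: "\<And>n. \<zeta> n \<in> ?S" "\<zeta> \<longlonglongrightarrow> x"
      by (auto simp: islimpt_sequential)
    \<comment> \<open>Compact set catching the preimages of points near x: the radius comes from
      \<open>shift_preimage_bound\<close>, and the height from
      \<open>Im (w - t g(w)) \<le> Im w\<close>.\<close>
    define K where "K = cball 0 (2 * (cmod x + 1) + 2 * t * cmod (g b) + cmod b) \<inter> {w. Im w \<ge> Im x / 2}"
    have "compact K"
      unfolding K_def by (intro compact_Int_closed compact_cball closed_halfspace_Im_ge)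
    moreover have K: "K \<subseteq> upper_half_plane"
      using x by (auto simp: K_def)
    ultimately have "closed (?f ` K)"
      by (intro compact_imp_closed compact_continuous_image)
        (blast intro: continuous_on_subset[OF holomorphic_on_imp_continuous_on[OF shift_holomorphic]])+
    moreover have "\<forall>\<^sub>F n in sequentially. \<zeta> n \<in> ?f ` K"
    proof -
      have 1: "\<forall>\<^sub>F n in sequentially. cmod (\<zeta> n) < cmod x + 1"
        using order_tendstoD(2)[OF tendsto_norm[OF \<zeta>(2)], of "cmod x + 1"] by simp
      have 2: "\<forall>\<^sub>F n in sequentially. Im (\<zeta> n) > Im x / 2"
        using order_tendstoD(1)[OF tendsto_Im[OF \<zeta>(2)], of "Im x / 2"] x by simp
      show ?thesis using 1 2
      proof eventually_elim
        case (elim n)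
        obtain w where w: "w \<in> shift_domain t" "\<zeta> n = ?f w" using \<zeta>(1)[of n] by blast
        then have "cmod w \<le> 2 * cmod (\<zeta> n) + 2 * t * cmod (g b) + cmod b"
          using shift_preimage_bound(2)[OF assms order_refl _ _ b, of w] by (simp add: shift_domain_def)
        moreover have "Im (\<zeta> n) \<le> Im w"
          using w Im_nonneg[of w] assms by (simp add: shift_domain_def)
        ultimately have "w \<in> K"
          using elim by (simp add: K_def)
        then show ?case using w(2) by blast
      qed
    qed
    ultimately have "x \<in> ?f ` K"
      using Lim_in_closed_set \<zeta>(2) sequentially_bot by blast
    then obtain w where "w \<in> K" "x = ?f w" by blast
    then show "x \<in> ?S"
      using K x by (auto simp: shift_domain_def)
  qed
  have "b \<in> shift_domain t"
    using b by (simp add: shift_domain_def)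
  then have "?S \<noteq> {}" by blast
  moreover have "connected upper_half_plane"
    by (simp add: convex_connected convex_upper_half_plane)
  ultimately show ?thesis
    using op cl by (metis connected_clopen)
qed

definition subordination :: "real \<Rightarrow> complex \<Rightarrow> complex" where
  "subordination t z = (THE w. Im w > 0 \<and> w - of_real t * g w = z)"

lemma subordination_eqI:
  assumes "t > 0" "Im w > 0" "w - of_real t * g w = z" "Im z > 0"
  shows "subordination t z = w"
  unfolding subordination_def
proof (rule the_equality)
  show "Im w > 0 \<and> w - of_real t * g w = z"
    using assms by blast
  show "v = w" if "Im v > 0 \<and> v - of_real t * g v = z" for v
    by (rule shift_injective[of t]) (simp_all add: assms that)
qed

lemma
  assumes "t > 0" "Im z > 0"
  shows subordination_pos: "Im (subordination t z) > 0"
    and subordination_eq: "subordination t z - of_real t * g (subordination t z) = z"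
proof -
  have "z \<in> (\<lambda>w. w - of_real t * g w) ` shift_domain t"
    using shift_image[OF assms(1)] assms(2) by simp
  then obtain w where "Im w > 0" "w - of_real t * g w = z"
    by (auto simp: shift_domain_def)
  moreover from this have "subordination t z = w"
    using assms by (intro subordination_eqI) auto
  ultimately show "Im (subordination t z) > 0"
    "subordination t z - of_real t * g (subordination t z) = z" by auto
qed

lemma subordination_increment:
  assumes "t > 0" "Im z > 0"
  shows "subordination t z - z = of_real t * g (subordination t z)"
proof -
  have "b = a - z" if "a - b = z" for a b :: complex
    using that by auto
  from this[OF subordination_eq[OF assms]] show ?thesis by simp
qed

lemma subordination_holomorphic:
  assumes "t > 0"
  shows "subordination t holomorphic_on upper_half_plane"
proof -
  obtain k where k: "k holomorphic_on (\<lambda>w. w - of_real t * g w) ` shift_domain t"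
    "\<And>w. w \<in> shift_domain t \<Longrightarrow> k (w - of_real t * g w) = w"
    using holomorphic_has_inverse[OF holomorphic_on_subset[OF shift_holomorphic shift_domain_subset]
        open_shift_domain inj_on_shift[OF assms]] by metis
  have "k z = subordination t z" if "z \<in> upper_half_plane" for z
  proof -
    have z: "Im z > 0" using that by simp
    then have "subordination t z \<in> shift_domain t"
      unfolding shift_domain_def mem_Collect_eq subordination_eq[OF assms z]
      using subordination_pos[OF assms z] by blast
    from k(2)[OF this] show ?thesis
      unfolding subordination_eq[OF assms z] .
  qed
  with k(1) show ?thesis
    unfolding shift_image[OF assms] by (rule holomorphic_transform)
qed

text \<open>Here z itself is the anchor. As \<open>subordination t z - z\<close> equals
  \<open>t * g (subordination t z)\<close>, the contraction estimate bounds the difference of the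
  two values of g by half of the larger unknown, which is then absorbed.\<close>

lemma subordinated_bound:
  assumes "t > 0" "Im z > 0" "t * Im (g z) \<le> Im z / 4"
  shows "cmod (g (subordination t z)) \<le> 2 * cmod (g z)"
proof -
  let ?w = "subordination t z"
  have "t * cmod (g ?w - g z) \<le> cmod (?w - z) / 2"
    using assms subordination_pos subordination_eq
    by (intro shift_preimage_bound(1)[where T = t]) auto
  also have "?w - z = of_real t * g ?w"
    using subordination_increment[OF assms(1,2)] .
  also have "cmod \<dots> / 2 = t * (cmod (g ?w) / 2)"
    using assms by (simp add: norm_mult)
  finally have "cmod (g ?w - g z) \<le> cmod (g ?w) / 2"
    using assms by (simp add: mult_le_cancel_left_pos)
  then show ?thesis
    using norm_triangle_sub[of "g ?w" "g z"] by linarith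
qed

lemma subordinated_holomorphic:
  assumes "t > 0"
  shows "(\<lambda>z. g (subordination t z)) holomorphic_on upper_half_plane"
proof -
  have "g \<circ> subordination t holomorphic_on upper_half_plane"
    by (rule holomorphic_on_compose_gen[OF subordination_holomorphic[OF assms] holomorphic])
      (simp add: image_subset_iff subordination_pos assms)
  then show ?thesis by (simp add: o_def)
qed

text \<open>The factor c = 1 + t yields the free power and c = 1 the composite map with the Boolean
  power.\<close>

lemma pick_perturbation_subordinated:
  assumes "t > 0" "c \<ge> 0"
  shows "pick_perturbation (\<lambda>z. of_real c * g (subordination t z))"
proof (rule pick_perturbation.intro)
  show "(\<lambda>z. of_real c * g (subordination t z)) holomorphic_on upper_half_plane"
    by (rule holomorphic_on_mult[OF holomorphic_on_const subordinated_holomorphic[OF assms(1)]])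
  show "Im (of_real c * g (subordination t z)) \<ge> 0" if "Im z > 0" for z
    using Im_nonneg subordination_pos assms that by simp
  \<comment> \<open>The constant 1 / (4 t) is the smallness that \<open>subordinated_bound\<close>
    demands at the point iy.\<close>
  have "\<forall>\<^sub>F y in at_top. y > 0 \<and> cmod (g (\<i> * complex_of_real y)) \<le> 1 / (4 * t) * y"
    using assms by (intro small_on_imaginary_axis) simp
  then have ev: "\<forall>\<^sub>F y in at_top. cmod (of_real c * g (subordination t (\<i> * of_real y)) / of_real y)
      \<le> cmod (g (\<i> * complex_of_real y) / of_real y) * (2 * c)"
  proof eventually_elim
    case (elim y)
    have "Im (g (\<i> * complex_of_real y)) \<le> 1 / (4 * t) * y"
      using elim abs_Im_le_cmod[of "g (\<i> * complex_of_real y)"] by linarith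
    then have "cmod (g (subordination t (\<i> * of_real y))) \<le> 2 * cmod (g (\<i> * of_real y))"
      using elim assms by (intro subordinated_bound) (auto simp: field_simps)
    then have "c * cmod (g (subordination t (\<i> * of_real y))) \<le> c * (2 * cmod (g (\<i> * of_real y)))"
      using assms(2) by (rule mult_left_mono)
    then show ?case
      using elim assms by (simp add: norm_mult norm_divide divide_simps mult_ac)
  qed
  have "((\<lambda>y. cmod (g (\<i> * complex_of_real y) / of_real y) * (2 * c)) \<longlongrightarrow> 0) at_top"
    using tendsto_mult_left_zero[OF tendsto_norm_zero[OF vertical_limit]] .
  then show "((\<lambda>y. of_real c * g (subordination t (\<i> * complex_of_real y)) / complex_of_real y) \<longlongrightarrow> 0) at_top"
    by (rule Lim_null_comparison[OF ev])
qed

section \<open>Characteristics and the Burgers equation\<close>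

text \<open>With w the value of \<open>subordination s z\<close>, the equation
  \<open>w - s g(w) = z\<close> can be rewritten as \<open>w - t g(w) = z + (s - t) g(w)\<close>:
  the same w solves the equation for t at a shifted point.\<close>

lemma subordinated_characteristic:
  assumes "s > 0" "t > 0" "Im z > 0"
    and "Im (z + of_real (s - t) * g (subordination s z)) > 0"
  shows "subordination t (z + of_real (s - t) * g (subordination s z)) = subordination s z"
proof (rule subordination_eqI[OF assms(2) subordination_pos[OF assms(1,3)] _ assms(4)])
  let ?w = "subordination s z"
  have "?w - of_real t * g ?w = (?w - of_real s * g ?w) + of_real (s - t) * g ?w"
    by (simp add: algebra_simps)
  then show "?w - of_real t * g ?w = z + of_real (s - t) * g ?w"
    unfolding subordination_eq[OF assms(1,3)] .
qed

lemma subordinated_bounded: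
  assumes "t > 0" "Im z > 0"
  obtains B where "\<forall>\<^sub>F s in at t. s > 0 \<and> cmod (g (subordination s z)) \<le> B"
proof -
  have "2 * t > 0" using assms by simp
  then obtain b where b: "Im b > 0" "2 * t * Im (g b) \<le> Im b / 4"
    by (rule anchor_exists)
  define R where "R = 2 * cmod z + 2 * (2 * t) * cmod (g b) + cmod b"
  \<comment> \<open>The upper end 2 t lets one anchor serve all s; the lower end t / 2 bounds the
    division by s when g is recovered from \<open>s * g ?w = ?w - z\<close>.\<close>
  have "\<forall>\<^sub>F s in at t. s \<in> {t / 2<..<2 * t}"
    using assms by (intro eventually_at_in_open') auto
  then have "\<forall>\<^sub>F s in at t. s > 0 \<and> cmod (g (subordination s z)) \<le> 2 / t * (R + cmod z)"
  proof eventually_elim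
    case (elim s)
    then have s: "s > 0" "s \<le> 2 * t" "t / 2 < s" using assms by auto
    let ?w = "subordination s z"
    have "cmod ?w \<le> R"
      using shift_preimage_bound(2)[of s "2 * t" ?w b] s assms b
        subordination_pos[of s z] subordination_eq[of s z] by (simp add: R_def)
    moreover have "of_real s * g ?w = ?w - z"
      using subordination_increment[of s z] s assms by simp
    moreover have "cmod (of_real s * g ?w) = s * cmod (g ?w)"
      using s by (simp add: norm_mult)
    ultimately have "s * cmod (g ?w) \<le> R + cmod z"
      using norm_triangle_ineq4[of ?w z] by simp
    moreover have "t / 2 * cmod (g ?w) \<le> s * cmod (g ?w)"
      using s by (intro mult_right_mono) auto
    ultimately have "t / 2 * cmod (g ?w) \<le> R + cmod z" by linarith
    then show ?case using s assms by (simp add: field_simps)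
  qed
  then show ?thesis using that by blast
qed

text \<open>The chain is: boundedness of \<open>h s z\<close> near t gives \<open>u s\<close>
  tending to z; then \<open>h s z = h t (u s)\<close> gives continuity in s; continuity makes u
  differentiable at t with derivative \<open>h t z\<close>; and the chain rule for the holomorphic
  function \<open>h t\<close> gives the equation.\<close>

theorem subordinated_Burgers:
  assumes "t > 0" "Im z > 0"
  defines "h \<equiv> (\<lambda>s z. g (subordination s z))"
  shows "h t field_differentiable (at z)"
    and "((\<lambda>s. h s z) has_vector_derivative h t z * deriv (h t) z) (at t)"
proof -
  show diff: "h t field_differentiable (at z)"
    using subordinated_holomorphic[OF assms(1)] assms(2) open_upper_half_plane
    unfolding h_def by (intro holomorphic_on_imp_differentiable_at) auto
  define u where "u = (\<lambda>s. z + of_real (s - t) * h s z)"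
  have [simp]: "u t = z" by (simp add: u_def)
  obtain B where B: "\<forall>\<^sub>F s in at t. s > 0 \<and> cmod (h s z) \<le> B"
    using subordinated_bounded[OF assms(1,2)] unfolding h_def by blast
  have u_lim: "(u \<longlongrightarrow> z) (at t)"
  proof -
    have "((\<lambda>s. of_real (s - t) * h s z) \<longlongrightarrow> 0) (at t)"
    proof (rule Lim_null_comparison)
      show "\<forall>\<^sub>F s in at t. cmod (of_real (s - t) * h s z) \<le> \<bar>s - t\<bar> * B"
        using B by eventually_elim (auto simp del: of_real_diff simp: norm_mult intro: mult_left_mono)
      show "((\<lambda>s. \<bar>s - t\<bar> * B) \<longlongrightarrow> 0) (at t)"
        by (auto intro!: tendsto_eq_intros)
    qed
    from tendsto_add[OF tendsto_const this, of z] show ?thesis by (simp add: u_def)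
  qed
  have "\<forall>\<^sub>F s in at t. Im (u s) > 0"
    using order_tendstoD(1)[OF tendsto_Im[OF u_lim]] assms(2) .
  with B have h_char: "\<forall>\<^sub>F s in at t. h t (u s) = h s z"
    by eventually_elim (use subordinated_characteristic assms in \<open>simp add: h_def u_def\<close>)
  have "((\<lambda>s. h t (u s)) \<longlongrightarrow> h t z) (at t)"
    using diff u_lim by (intro isCont_tendsto_compose[of _ "h t"])
      (auto dest: field_differentiable_imp_continuous_at)
  then have h_lim: "((\<lambda>s. h s z) \<longlongrightarrow> h t z) (at t)"
    by (rule Lim_transform_eventually) (rule h_char)
  have "(u has_vector_derivative h t z) (at t)"
    unfolding has_vector_derivative_def has_derivative_at_within
  proof (intro conjI bounded_linear_scaleR_left)
    \<comment> \<open>The remainder \<open>u s - u t - (s - t) h t z\<close> equals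
      \<open>(s - t) (h s z - h t z)\<close>, so continuity of h in s suffices.\<close>
    have "((\<lambda>s. ((s - t) /\<^sub>R \<bar>s - t\<bar>) *\<^sub>R (h s z - h t z)) \<longlongrightarrow> 0) (at t)"
    proof (rule Lim_null_comparison)
      show "\<forall>\<^sub>F s in at t. norm (((s - t) /\<^sub>R \<bar>s - t\<bar>) *\<^sub>R (h s z - h t z)) \<le> cmod (h s z - h t z)"
      proof (intro always_eventually allI)
        fix s show "norm (((s - t) /\<^sub>R \<bar>s - t\<bar>) *\<^sub>R (h s z - h t z)) \<le> cmod (h s z - h t z)"
          by (cases "s = t") (simp_all add: abs_mult)
      qed
      show "((\<lambda>s. cmod (h s z - h t z)) \<longlongrightarrow> 0) (at t)"
        using h_lim by (simp add: tendsto_norm_zero_iff LIM_zero_iff)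
    qed
    then show "((\<lambda>s. (u s - u t - (s - t) *\<^sub>R h t z) /\<^sub>R norm (s - t)) \<longlongrightarrow> 0) (at t)"
      by (rule Lim_transform_eventually)
        (auto simp: u_def scaleR_conv_of_real algebra_simps intro!: always_eventually)
  qed
  moreover have "(h t has_field_derivative deriv (h t) z) (at (u t))"
    using diff by (simp add: DERIV_deriv_iff_field_differentiable)
  ultimately have "((\<lambda>s. h t (u s)) has_vector_derivative h t z * deriv (h t) z) (at t)"
    using field_vector_diff_chain_at[of u "h t z" t "h t" "deriv (h t) z"] by (simp add: o_def)
  \<comment> \<open>The identity also holds at s = t, because \<open>u t = z\<close>; this fills in
    the point missing from the punctured neighbourhood.\<close>
  moreover have "\<forall>\<^sub>F s in nhds t. h t (u s) = h s z"
    using h_char unfolding eventually_nhds_conv_at by simp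
  ultimately show "((\<lambda>s. h s z) has_vector_derivative h t z * deriv (h t) z) (at t)"
    using has_vector_derivative_cong_ev[where x = t and S = UNIV and f = "\<lambda>s. h t (u s)" and g = "\<lambda>s. h s z"] \<open>u t = z\<close> by simp
qed

end

section \<open>Cauchy transforms\<close>

context real_distribution
begin

lemma Im_le_cmod_diff_of_real: "Im z \<le> cmod (z - of_real s)"
  using abs_Im_le_cmod[of "z - of_real s"] by simp

lemma cauchy_kernel_bound:
  assumes "0 < c" "c \<le> Im z"
  shows "cmod (1 / (z - of_real s) ^ n) \<le> 1 / c ^ n"
proof -
  have "c ^ n \<le> cmod (z - of_real s) ^ n"
    using assms Im_le_cmod_diff_of_real[of z s] by (intro power_mono) auto
  then show ?thesis
    using assms by (simp add: norm_divide norm_power frac_le)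
qed

lemma integrable_cauchy_kernel_power:
  assumes "Im z > 0"
  shows "integrable M (\<lambda>s. 1 / (z - complex_of_real s) ^ n)"
  by (rule integrable_const_bound[where B = "1 / Im z ^ n"])
    (use cauchy_kernel_bound[OF assms order_refl] in auto)

text \<open>Arbitrary powers n are treated because the uniqueness theorem recovers a measure from
  all derivatives of its Cauchy transform.\<close>

lemma has_field_derivative_cauchy_kernel_power:
  assumes z: "Im z > 0"
  shows "((\<lambda>z. LINT s|M. 1 / (z - complex_of_real s) ^ n) has_field_derivative
           (LINT s|M. - of_nat n * (1 / (z - complex_of_real s) ^ Suc n))) (at z)"
proof -
  \<comment> \<open>On the ball of radius Im z / 2 all points have height at least r, so the kernels
    are bounded uniformly in s. The mean value inequality there turns this into a constant
    dominating the difference quotients.\<close>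
  define r where "r = Im z / 2"
  define B where "B = ball z r"
  have r: "0 < r" and zB: "z \<in> B" using z by (auto simp: r_def B_def)
  have Im_B: "r \<le> Im w" if "w \<in> B" for w
    using that abs_Im_le_cmod[of "z - w"] by (auto simp: B_def dist_norm r_def field_simps)
  have kernel_deriv: "((\<lambda>z. 1 / (z - complex_of_real s) ^ n) has_field_derivative
      - of_nat n * (1 / (w - complex_of_real s) ^ Suc n)) (at w within S)" if "w \<in> B" for s w S
  proof -
    have "w - of_real s \<noteq> 0"
      using Im_B[OF that] r by (auto simp: complex_eq_iff)
    then have "((\<lambda>z. inverse (z - complex_of_real s)) has_field_derivative
        - (inverse (w - complex_of_real s))\<^sup>2) (at w within S)"
      by (auto intro!: derivative_eq_intros simp: power2_eq_square)
    from DERIV_power[OF this, of n]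
    have "((\<lambda>z. inverse (z - complex_of_real s) ^ n) has_field_derivative
        - of_nat n * inverse (w - complex_of_real s) ^ Suc n) (at w within S)"
      by (rule DERIV_cong) (cases n; simp add: power2_eq_square algebra_simps)
    then show ?thesis
      by (simp add: power_inverse divide_inverse)
  qed
  have "((\<lambda>z. LINT s|M. 1 / (z - complex_of_real s) ^ n) has_field_derivative
      (LINT s|M. - of_nat n * (1 / (z - complex_of_real s) ^ Suc n))) (at z within B)"
    unfolding has_field_derivative_iff tendsto_at_iff_sequentially
  proof (intro allI impI)
    fix X assume X: "\<forall>i. X i \<in> B - {z}" "X \<longlonglongrightarrow> z"
    have Im_X: "0 < Im (X i)" for i using X(1) Im_B[of "X i"] r by force
    let ?q = "\<lambda>i s. (1 / (X i - complex_of_real s) ^ n - 1 / (z - complex_of_real s) ^ n) / (X i - z)"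
    have "(\<lambda>i. LINT s|M. ?q i s) \<longlonglongrightarrow> (LINT s|M. - of_nat n * (1 / (z - complex_of_real s) ^ Suc n))"
    proof (rule integral_dominated_convergence[where w = "\<lambda>_. real n * (1 / r ^ Suc n)"])
      show "AE s in M. (\<lambda>i. ?q i s) \<longlonglongrightarrow> - of_nat n * (1 / (z - complex_of_real s) ^ Suc n)"
        using kernel_deriv[OF zB, of _ B] X
        unfolding has_field_derivative_iff tendsto_at_iff_sequentially by (auto simp: o_def)
      show "AE s in M. norm (?q i s) \<le> real n * (1 / r ^ Suc n)" for i
      proof (rule AE_I2)
        fix s
        have "cmod (1 / (X i - complex_of_real s) ^ n - 1 / (z - complex_of_real s) ^ n)
            \<le> real n * (1 / r ^ Suc n) * cmod (X i - z)"
        proof (rule field_differentiable_bound[where S = B])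
          show "cmod (- of_nat n * (1 / (w - complex_of_real s) ^ Suc n)) \<le> real n * (1 / r ^ Suc n)"
            if "w \<in> B" for w
          proof -
            have "real n * cmod (1 / (w - complex_of_real s) ^ Suc n) \<le> real n * (1 / r ^ Suc n)"
              by (rule mult_left_mono[OF cauchy_kernel_bound[OF r Im_B[OF that]]]) simp
            then show ?thesis by (simp only: norm_mult norm_minus_cancel norm_of_nat)
          qed
        qed (use X kernel_deriv zB in \<open>auto simp: B_def simp del: power_Suc\<close>)
        moreover have "0 < cmod (X i - z)" using X(1) by auto
        ultimately show "norm (?q i s) \<le> real n * (1 / r ^ Suc n)"
          by (simp only: norm_divide pos_divide_le_eq)
      qed
    qed auto
    moreover have "(LINT s|M. ?q i s)
        = ((LINT s|M. 1 / (X i - complex_of_real s) ^ n) - (LINT s|M. 1 / (z - complex_of_real s) ^ n)) / (X i - z)" for i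
      using integrable_cauchy_kernel_power[OF Im_X[of i], of n] integrable_cauchy_kernel_power[OF z, of n]
      by simp
    ultimately show "(((\<lambda>y. ((LINT s|M. 1 / (y - complex_of_real s) ^ n) - (LINT s|M. 1 / (z - complex_of_real s) ^ n)) / (y - z)) \<circ> X)
        \<longlonglongrightarrow> (LINT s|M. - of_nat n * (1 / (z - complex_of_real s) ^ Suc n)))"
      by (simp only: o_def)
  qed
  then show ?thesis
    using zB at_within_open[of z B] by (simp add: B_def)
qed

lemma cauchy_transform_holomorphic: "cauchy_transform M holomorphic_on upper_half_plane"
proof (rule holomorphic_onI)
  fix z assume "z \<in> upper_half_plane"
  then have "(cauchy_transform M has_field_derivative
      (LINT s|M. - of_nat 1 * (1 / (z - complex_of_real s) ^ Suc 1))) (at z)"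
    using has_field_derivative_cauchy_kernel_power[of z 1]
    unfolding cauchy_transform_def[abs_def] by simp
  then show "cauchy_transform M field_differentiable at z within upper_half_plane"
    using field_differentiable_at_within field_differentiable_def by blast
qed

lemma integrable_cauchy_kernel: "Im z > 0 \<Longrightarrow> integrable M (\<lambda>s. 1 / (z - complex_of_real s))"
  using integrable_cauchy_kernel_power[of z 1] by simp

lemma Im_cauchy_transform:
  assumes "Im z > 0"
  shows "integrable M (\<lambda>s. 1 / (cmod (z - complex_of_real s))\<^sup>2)"
    and "Im (cauchy_transform M z) = - Im z * (LINT s|M. 1 / (cmod (z - complex_of_real s))\<^sup>2)"
proof -
  show "integrable M (\<lambda>s. 1 / (cmod (z - complex_of_real s))\<^sup>2)"
    using integrable_norm[OF integrable_cauchy_kernel_power[OF assms, of 2]]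
    by (simp add: norm_divide norm_power)
  have "Im (cauchy_transform M z) = (LINT s|M. Im (1 / (z - complex_of_real s)))"
    unfolding cauchy_transform_def using integrable_cauchy_kernel[OF assms] by simp
  also have "(\<lambda>s. Im (1 / (z - complex_of_real s))) = (\<lambda>s. - Im z * (1 / (cmod (z - complex_of_real s))\<^sup>2))"
    by (simp add: Im_divide cmod_power2 fun_eq_iff)
  finally show "Im (cauchy_transform M z) = - Im z * (LINT s|M. 1 / (cmod (z - complex_of_real s))\<^sup>2)"
    by (simp only: integral_mult_right_zero)
qed

lemma Im_cauchy_transform_neg:
  assumes "Im z > 0"
  shows "Im (cauchy_transform M z) < 0"
proof -
  have "(LINT s|M. 0) < (LINT s|M. 1 / (cmod (z - complex_of_real s))\<^sup>2)"
  proof (rule integral_less_AE_space)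
    show "AE s in M. 0 < 1 / (cmod (z - complex_of_real s))\<^sup>2"
      using assms by (auto simp: complex_eq_iff)
  qed (use Im_cauchy_transform(1)[OF assms] emeasure_space_1 in auto)
  then show ?thesis
    using assms by (simp add: Im_cauchy_transform(2) mult_pos_pos)
qed

text \<open>Nonnegativity of the variance of |1 / (z - s)| gives the Cauchy--Schwarz step, and the
  second moment is -Im G / Im z. Divided by |G|^2 this becomes \<open>Im z \<le> Im (F z)\<close>,
  the source of \<open>Im_nonneg\<close>.\<close>

lemma cauchy_transform_power2_le:
  assumes "Im z > 0"
  shows "Im z * (cmod (cauchy_transform M z))\<^sup>2 \<le> - Im (cauchy_transform M z)"
proof -
  let ?f = "\<lambda>s. cmod (1 / (z - complex_of_real s))"
  have int: "integrable M ?f" "integrable M (\<lambda>s. (?f s)\<^sup>2)"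
    using integrable_norm[OF integrable_cauchy_kernel[OF assms]] Im_cauchy_transform(1)[OF assms]
    by (simp_all add: norm_divide power_divide)
  have "cmod (cauchy_transform M z) \<le> expectation ?f"
    unfolding cauchy_transform_def by (rule integral_norm_bound)
  then have "(cmod (cauchy_transform M z))\<^sup>2 \<le> (expectation ?f)\<^sup>2"
    by (intro power_mono) auto
  also have "\<dots> \<le> expectation (\<lambda>s. (?f s)\<^sup>2)"
    using variance_eq[OF int] variance_positive[of ?f] by simp
  also have "\<dots> = - Im (cauchy_transform M z) / Im z"
    using assms by (simp add: Im_cauchy_transform(2) norm_divide power_divide)
  finally show ?thesis
    using assms by (simp add: field_simps)
qed

lemma cauchy_transform_nonzero: "Im z > 0 \<Longrightarrow> cauchy_transform M z \<noteq> 0"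
  using Im_cauchy_transform_neg[of z] by auto

lemma Im_le_recip_cauchy_transform:
  assumes "Im z > 0"
  shows "Im z \<le> Im (recip_cauchy_transform M z)"
proof -
  have "0 < (cmod (cauchy_transform M z))\<^sup>2"
    using cauchy_transform_nonzero[OF assms] by simp
  moreover have "Im (recip_cauchy_transform M z) = - Im (cauchy_transform M z) / (cmod (cauchy_transform M z))\<^sup>2"
    by (simp add: recip_cauchy_transform_def Im_divide cmod_power2)
  ultimately show ?thesis
    using cauchy_transform_power2_le[OF assms] by (simp only: pos_le_divide_eq)
qed

lemma recip_cauchy_transform_holomorphic: "recip_cauchy_transform M holomorphic_on upper_half_plane"
  unfolding recip_cauchy_transform_def[abs_def]
  by (intro holomorphic_on_divide holomorphic_on_const cauchy_transform_holomorphic)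
    (simp add: cauchy_transform_nonzero)

lemma cauchy_transform_vertical_limit:
  "((\<lambda>y. \<i> * complex_of_real y * cauchy_transform M (\<i> * complex_of_real y)) \<longlongrightarrow> 1) at_top"
proof -
  have "((\<lambda>y. LINT s|M. \<i> * complex_of_real y / (\<i> * complex_of_real y - complex_of_real s)) \<longlongrightarrow> (LINT s|M. 1)) at_top"
  proof (rule integral_dominated_convergence_at_top[where w = "\<lambda>_. 1"])
    show "\<forall>\<^sub>F y in at_top. AE s in M. norm (\<i> * complex_of_real y / (\<i> * complex_of_real y - complex_of_real s)) \<le> 1"
      using eventually_gt_at_top[of 0]
    proof eventually_elim
      case (elim y)
      have "y \<le> cmod (\<i> * complex_of_real y - complex_of_real s)" for s
        using Im_le_cmod_diff_of_real[of "\<i> * complex_of_real y" s] by simp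
      then show ?case
        using elim by (simp add: norm_divide norm_mult divide_le_eq_1)
    qed
    have "((\<lambda>y. \<i> * complex_of_real y / (\<i> * complex_of_real y - complex_of_real s)) \<longlongrightarrow> 1) at_top" for s
    proof -
      have "((\<lambda>y. 1 / (1 + \<i> * complex_of_real (s / y))) \<longlongrightarrow> 1 / (1 + \<i> * complex_of_real 0)) at_top"
        by (intro tendsto_intros tendsto_divide_0[OF tendsto_const] filterlim_at_top_imp_at_infinity filterlim_ident) auto
      moreover have "\<forall>\<^sub>F y in at_top. 1 / (1 + \<i> * complex_of_real (s / y)) = \<i> * complex_of_real y / (\<i> * complex_of_real y - complex_of_real s)"
        using eventually_gt_at_top[of 0]
      proof eventually_elim
        case (elim y)
        have "\<i> * complex_of_real y - complex_of_real s = \<i> * complex_of_real y * (1 + \<i> * complex_of_real (s / y))"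
          using elim by (simp add: field_simps)
        then show ?case using elim by simp
      qed
      ultimately show ?thesis
        using Lim_transform_eventually by fastforce
    qed
    then show "AE s in M. ((\<lambda>y. \<i> * complex_of_real y / (\<i> * complex_of_real y - complex_of_real s)) \<longlongrightarrow> 1) at_top"
      by simp
  qed auto
  moreover have "(LINT s|M. \<i> * complex_of_real y / (\<i> * complex_of_real y - complex_of_real s))
      = \<i> * complex_of_real y * cauchy_transform M (\<i> * complex_of_real y)" for y
    unfolding cauchy_transform_def integral_mult_right_zero[symmetric] by simp
  moreover have "(LINT s|M. 1 :: complex) = 1"
    using prob_space by simp
  ultimately show ?thesis by (simp only:)
qed

text \<open>From here on \<open>subordination\<close> inside \<open>real_distribution\<close> refers
  to \<open>F(z) - z\<close> of the measure M at hand. The vertical limit is that of iy G(iy), since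
  (F(iy) - iy) / y = i (1 / (iy G(iy)) - 1).\<close>

sublocale pick_perturbation "\<lambda>z. recip_cauchy_transform M z - z"
proof
  show "(\<lambda>z. recip_cauchy_transform M z - z) holomorphic_on upper_half_plane"
    by (intro holomorphic_intros recip_cauchy_transform_holomorphic)
  show "Im (recip_cauchy_transform M z - z) \<ge> 0" if "Im z > 0" for z
    using Im_le_recip_cauchy_transform[OF that] by simp
  have "((\<lambda>y. \<i> * (1 / (\<i> * complex_of_real y * cauchy_transform M (\<i> * complex_of_real y)) - 1)) \<longlongrightarrow> \<i> * (1 / 1 - 1)) at_top"
    by (intro tendsto_intros cauchy_transform_vertical_limit) auto
  then have "((\<lambda>y. \<i> * (1 / (\<i> * complex_of_real y * cauchy_transform M (\<i> * complex_of_real y)) - 1)) \<longlongrightarrow> 0) at_top"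
    by simp
  moreover have "\<forall>\<^sub>F y in at_top. \<i> * (1 / (\<i> * complex_of_real y * cauchy_transform M (\<i> * complex_of_real y)) - 1)
      = (recip_cauchy_transform M (\<i> * complex_of_real y) - \<i> * complex_of_real y) / complex_of_real y"
    using eventually_gt_at_top[of 0]
    by eventually_elim (use cauchy_transform_nonzero in \<open>simp add: recip_cauchy_transform_def field_simps\<close>)
  ultimately show "((\<lambda>y. (recip_cauchy_transform M (\<i> * complex_of_real y) - \<i> * complex_of_real y) / complex_of_real y) \<longlongrightarrow> 0) at_top"
    by (rule Lim_transform_eventually)
qed

end

section \<open>Uniqueness of a measure with given Cauchy transform\<close>

text \<open>The derivative of \<open>Ln (1 + w * h)\<close> at h = 0 is w, so n Ln (1 + w / n) tends
  to w; exponentiate. The index \<open>Suc n\<close> avoids division by zero.\<close>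

lemma tendsto_exp_limit_complex: "(\<lambda>n. (1 + w / of_nat (Suc n)) ^ Suc n) \<longlonglongrightarrow> exp (w::complex)"
proof -
  have "((\<lambda>h. Ln (1 + w * h)) has_field_derivative w) (at 0)"
    by (auto intro!: derivative_eq_intros)
  then have "((\<lambda>h. Ln (1 + w * h) / h) \<longlongrightarrow> w) (at 0)"
    by (simp add: has_field_derivative_iff)
  moreover have "filterlim (\<lambda>n. 1 / of_nat (Suc n) :: complex) (at 0) sequentially"
    unfolding filterlim_at by (auto intro!: LIMSEQ_Suc lim_1_over_n always_eventually simp del: of_nat_Suc)
  ultimately have "(\<lambda>n. Ln (1 + w * (1 / of_nat (Suc n))) / (1 / of_nat (Suc n))) \<longlonglongrightarrow> w"
    by (rule filterlim_compose)
  then have "(\<lambda>n. exp (of_nat (Suc n) * Ln (1 + w / of_nat (Suc n)))) \<longlonglongrightarrow> exp w"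
    by (intro tendsto_exp) (simp add: mult.commute del: of_nat_Suc)
  moreover have "\<forall>\<^sub>F n in sequentially. exp (of_nat (Suc n) * Ln (1 + w / of_nat (Suc n))) = (1 + w / of_nat (Suc n)) ^ Suc n"
  proof -
    have "(\<lambda>n. 1 + w * (1 / of_nat (Suc n))) \<longlonglongrightarrow> 1 + w * 0"
      by (intro tendsto_intros LIMSEQ_Suc[OF lim_1_over_n])
    then have "\<forall>\<^sub>F n in sequentially. 1 + w / of_nat (Suc n) \<noteq> 0"
      using tendsto_imp_eventually_ne[of "\<lambda>n. 1 + w / of_nat (Suc n)" 1 sequentially 0] by simp
    then show ?thesis
      by eventually_elim (simp add: exp_of_nat_mult del: of_nat_Suc power_Suc)
  qed
  ultimately show ?thesis by (rule Lim_transform_eventually)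
qed

text \<open>For \<open>z = in/u\<close> one has \<open>z / (z - s) = 1 / (1 + ius/n)\<close>, whose \<open>n\<close>-th power tends to
  \<open>exp (- ius)\<close>: derivatives of the Cauchy transform determine the characteristic function.\<close>

lemma (in real_distribution) char_limit_cauchy_kernel_power:
  assumes "u > 0"
  shows "(\<lambda>n. (\<i> * of_real (real (Suc n) / u)) ^ Suc n *
      (LINT s|M. 1 / (\<i> * of_real (real (Suc n) / u) - complex_of_real s) ^ Suc n)) \<longlonglongrightarrow> char M (- u)"
proof -
  define z where "z = (\<lambda>n. \<i> * complex_of_real (real (Suc n) / u))"
  have "(\<lambda>n. LINT s|M. (z n / (z n - complex_of_real s)) ^ Suc n) \<longlonglongrightarrow> (LINT s|M. iexp (- u * s))"
  proof (rule integral_dominated_convergence[where w = "\<lambda>_. 1"])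
    have "(\<lambda>n. (z n / (z n - complex_of_real s)) ^ Suc n) \<longlonglongrightarrow> iexp (- u * s)" for s
    proof -
      have "(\<lambda>n. inverse ((1 + \<i> * of_real (u * s) / of_nat (Suc n)) ^ Suc n)) \<longlonglongrightarrow> inverse (iexp (u * s))"
        by (intro tendsto_inverse tendsto_exp_limit_complex) simp
      moreover have "inverse ((1 + \<i> * of_real (u * s) / of_nat (Suc n)) ^ Suc n) = (z n / (z n - complex_of_real s)) ^ Suc n" for n
      proof -
        have "z n - complex_of_real s = z n * (1 + \<i> * of_real (u * s) / of_nat (Suc n))" "z n \<noteq> 0"
          using assms by (auto simp: z_def field_simps simp del: of_nat_Suc)
        then show ?thesis
          by (simp add: power_one_over inverse_eq_divide del: power_Suc of_nat_Suc)
      qed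
      ultimately show ?thesis by (simp add: exp_minus)
    qed
    then show "AE s in M. (\<lambda>n. (z n / (z n - complex_of_real s)) ^ Suc n) \<longlonglongrightarrow> iexp (- u * s)"
      by simp
    show "AE s in M. norm ((z n / (z n - complex_of_real s)) ^ Suc n) \<le> 1" for n
    proof (rule AE_I2)
      fix s
      have "cmod (z n) = Im (z n)" using assms by (simp add: z_def norm_mult norm_divide del: of_nat_Suc)
      then have "cmod (z n / (z n - complex_of_real s)) \<le> 1"
        using Im_le_cmod_diff_of_real[of "z n" s] by (simp add: norm_divide divide_le_eq_1)
      then show "norm ((z n / (z n - complex_of_real s)) ^ Suc n) \<le> 1"
        unfolding norm_power by (intro power_le_one) auto
    qed
  qed auto
  moreover have "(LINT s|M. (z n / (z n - complex_of_real s)) ^ Suc n) = z n ^ Suc n * (LINT s|M. 1 / (z n - complex_of_real s) ^ Suc n)" for n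
    unfolding integral_mult_right_zero[symmetric] by (simp add: power_divide del: power_Suc)
  ultimately show ?thesis
    by (simp add: z_def char_def del: power_Suc of_nat_Suc)
qed

text \<open>Equal transforms have equal derivatives, hence equal integrals of all kernel powers, and
  the limit of these determines the characteristic function on the negative axis. Conjugation covers
  the positive axis, and Levy's theorem concludes.\<close>

theorem cauchy_transform_unique:
  assumes M: "real_distribution M" and N: "real_distribution N"
    and eq: "\<And>z. Im z > 0 \<Longrightarrow> cauchy_transform M z = cauchy_transform N z"
  shows "M = N"
proof -
  interpret M: real_distribution M by fact
  interpret N: real_distribution N by fact
  have eq_powers: "(LINT s|M. 1 / (z - complex_of_real s) ^ Suc n) = (LINT s|N. 1 / (z - complex_of_real s) ^ Suc n)"
    if "Im z > 0" for z n
    using that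
  proof (induction n arbitrary: z)
    case 0
    then show ?case using eq by (simp add: cauchy_transform_def)
  next
    case (Suc n)
    have "((\<lambda>z. LINT s|M. 1 / (z - complex_of_real s) ^ Suc n) has_field_derivative
           (LINT s|N. - of_nat (Suc n) * (1 / (z - complex_of_real s) ^ Suc (Suc n)))) (at z)"
    proof (rule has_field_derivative_transform_within_open)
      show "((\<lambda>z. LINT s|N. 1 / (z - complex_of_real s) ^ Suc n) has_field_derivative
           (LINT s|N. - of_nat (Suc n) * (1 / (z - complex_of_real s) ^ Suc (Suc n)))) (at z)"
        by (rule N.has_field_derivative_cauchy_kernel_power) fact
      show "(LINT s|N. 1 / (w - complex_of_real s) ^ Suc n) = (LINT s|M. 1 / (w - complex_of_real s) ^ Suc n)"
        if "w \<in> upper_half_plane" for w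
        using Suc.IH[of w] that by simp
    qed (use Suc.prems open_upper_half_plane in auto)
    with M.has_field_derivative_cauchy_kernel_power[OF Suc.prems, of "Suc n"]
    have "(LINT s|M. - of_nat (Suc n) * (1 / (z - complex_of_real s) ^ Suc (Suc n)))
        = (LINT s|N. - of_nat (Suc n) * (1 / (z - complex_of_real s) ^ Suc (Suc n)))"
      by (rule DERIV_unique)
    then have "- of_nat (Suc n) * (LINT s|M. 1 / (z - complex_of_real s) ^ Suc (Suc n))
        = - of_nat (Suc n) * (LINT s|N. 1 / (z - complex_of_real s) ^ Suc (Suc n))"
      by (simp only: integral_mult_right_zero)
    then show ?case
      by (simp only: mult_cancel_left neg_equal_0_iff_equal of_nat_eq_0_iff) simp
  qed
  have neg: "char M (- u) = char N (- u)" if "u > 0" for u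
  proof (rule LIMSEQ_unique[OF M.char_limit_cauchy_kernel_power[OF that]])
    have "Im (\<i> * of_real (real (Suc n) / u)) > 0" for n
      using that by (simp del: of_nat_Suc)
    from eq_powers[OF this] N.char_limit_cauchy_kernel_power[OF that]
    show "(\<lambda>n. (\<i> * of_real (real (Suc n) / u)) ^ Suc n *
      (LINT s|M. 1 / (\<i> * of_real (real (Suc n) / u) - complex_of_real s) ^ Suc n)) \<longlonglongrightarrow> char N (- u)"
      by (simp only:)
  qed
  have cnj_char: "char L u = cnj (char L (- u))" for L :: "real measure" and u
  proof -
    have "cnj (char L (- u)) = (LINT s|L. cnj (iexp (- u * s)))"
      unfolding char_def by simp
    also have "\<dots> = char L u"
      unfolding char_def by (intro Bochner_Integration.integral_cong refl) (simp add: exp_cnj)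
    finally show ?thesis by simp
  qed
  have "char M u = char N u" for u
  proof (cases u "0::real" rule: linorder_cases)
    case less
    then show ?thesis using neg[of "- u"] by simp
  next
    case equal
    then show ?thesis by (simp add: M.char_zero N.char_zero)
  next
    case greater
    then show ?thesis using neg[of u] cnj_char[of M u] cnj_char[of N u] by simp
  qed
  then show ?thesis
    by (intro Levy_uniqueness M N) auto
qed

section \<open>Stieltjes representation\<close>

text \<open>The contour is a rectangle with base [-R, R] on the real axis and height R. Its other
  three sides have total length 4 R, and the integrand is at most 4 B / R^2 there, whence the error
  16 B / R. Holomorphy slightly below the axis allows the base to lie on it.\<close>

lemma Poisson_rectangle_estimate:
  assumes holf: "f holomorphic_on {w. - d < Im w}" and "d > 0"
    and bound: "\<And>w. Im w \<ge> 0 \<Longrightarrow> cmod (f w) \<le> B"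
    and z: "Im z > 0" and R: "2 * cmod z < R"
  shows "(\<lambda>x. f (of_real x) / of_real ((cmod (of_real x - z))\<^sup>2)) integrable_on {-R..R}"
    and "cmod (integral {-R..R} (\<lambda>x. f (of_real x) / of_real ((cmod (of_real x - z))\<^sup>2))
           - of_real pi * f z / of_real (Im z)) \<le> 16 * B / R"
proof -
  \<comment> \<open>On the real axis \<open>(w - cnj z) (w - z) = \<bar>w - z\<bar>\<^sup>2\<close>, so one application of Cauchy's formula to
    \<open>f w / (w - cnj z)\<close> produces the Poisson kernel.\<close>
  define q where "q = (\<lambda>w. f w / (w - cnj z) / (w - z))"
  \<comment> \<open>The minimum keeps S inside the domain of f and keeps the pole at
    \<open>cnj z\<close> outside S.\<close>
  define S where "S = {w. - min d (Im z) < Im w}"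
  have "R > 0" using R norm_ge_zero[of z] by linarith
  have "B \<ge> 0" using order_trans[OF norm_ge_zero bound[of 0]] by simp
  have S: "convex S" "open S" and Szero: "{w. Im w \<ge> 0} \<subseteq> S"
    using \<open>d > 0\<close> z by (auto simp: S_def convex_halfspace_Im_gt open_halfspace_Im_gt)
  have cnj_notin: "w \<noteq> cnj z" if "w \<in> S" for w
    using that by (auto simp: S_def)
  have f_S: "f holomorphic_on S"
    by (rule holomorphic_on_subset[OF holf]) (auto simp: S_def)
  have k: "(\<lambda>w. f w / (w - cnj z)) holomorphic_on S"
    using cnj_notin by (intro holomorphic_intros f_S) auto
  then have cont_q: "continuous_on (S - {z}) q"
    unfolding q_def
    by (intro continuous_intros continuous_on_subset[OF holomorphic_on_imp_continuous_on[OF k]]) auto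
  define a2 a3 a4 where "a2 = Complex R 0" and "a3 = Complex R R" and "a4 = Complex (- R) R"
  define p where "p = rectpath (of_real (- R)) a3"
  have p_eq: "p = linepath (of_real (- R)) (of_real R) +++ linepath (of_real R) a3 +++ linepath a3 a4 +++ linepath a4 (of_real (- R))"
    by (simp add: p_def rectpath_def Let_def a3_def a4_def complex_of_real_def)
  have z_box: "z \<in> box (of_real (- R)) a3"
    using z R abs_Re_le_cmod[of z] abs_Im_le_cmod[of z] \<open>R > 0\<close>
    by (auto simp: in_box_complex_iff a3_def)
  have segs: "closed_segment (of_real (- R)) (of_real R) \<subseteq> S - {z}"
    "closed_segment (of_real R) a3 \<subseteq> {w. Im w \<ge> 0 \<and> R \<le> cmod w}"
    "closed_segment a3 a4 \<subseteq> {w. Im w \<ge> 0 \<and> R \<le> cmod w}"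
    "closed_segment a4 (of_real (- R)) \<subseteq> {w. Im w \<ge> 0 \<and> R \<le> cmod w}"
  proof -
    have big: "r \<le> cmod w" if "\<bar>Re w\<bar> = r \<or> \<bar>Im w\<bar> = r" for w r
      using that abs_Re_le_cmod[of w] abs_Im_le_cmod[of w] by auto
    show "closed_segment (of_real (- R)) (of_real R) \<subseteq> S - {z}"
      using z Szero \<open>R > 0\<close> by (subst closed_segment_same_Im) auto
    show "closed_segment (of_real R) a3 \<subseteq> {w. Im w \<ge> 0 \<and> R \<le> cmod w}"
      using \<open>R > 0\<close> by (subst closed_segment_same_Re) (auto simp: a3_def closed_segment_eq_real_ivl intro!: big)
    show "closed_segment a3 a4 \<subseteq> {w. Im w \<ge> 0 \<and> R \<le> cmod w}"
      using \<open>R > 0\<close> by (subst closed_segment_same_Im) (auto simp: a3_def a4_def intro!: big)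
    show "closed_segment a4 (of_real (- R)) \<subseteq> {w. Im w \<ge> 0 \<and> R \<le> cmod w}"
      using \<open>R > 0\<close> by (subst closed_segment_same_Re) (auto simp: a4_def closed_segment_eq_real_ivl intro!: big)
  qed
  have far: "{w. Im w \<ge> 0 \<and> R \<le> cmod w} \<subseteq> S - {z}"
    using Szero R \<open>R > 0\<close> by auto
  have q_int: "q contour_integrable_on linepath a b" if "closed_segment a b \<subseteq> S - {z}" for a b
    by (rule contour_integrable_continuous_linepath[OF continuous_on_subset[OF cont_q that]])
  have "(q has_contour_integral (2 * pi * \<i> * winding_number p z * (f z / (z - cnj z)))) p"
    unfolding q_def
  proof (rule Cauchy_integral_formula_convex_simple[OF S(1) k])
    show "z \<in> interior S" using S(2) Szero z by (auto simp: interior_open)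
    have "path_image p \<subseteq> closed_segment (of_real (- R)) (of_real R) \<union> closed_segment (of_real R) a3
        \<union> closed_segment a3 a4 \<union> closed_segment a4 (of_real (- R))"
      unfolding p_eq by (auto simp: path_image_join)
    then show "path_image p \<subseteq> S - {z}" using segs far by blast
  qed (simp_all add: p_def)
  moreover have "winding_number p z = 1"
    unfolding p_def by (rule winding_number_rectpath[OF z_box])
  moreover have "z - cnj z = 2 * \<i> * of_real (Im z)"
    by (simp add: complex_eq_iff)
  ultimately have "(q has_contour_integral (of_real pi * f z / of_real (Im z))) p"
    by (simp add: field_simps)
  moreover have "(q has_contour_integral
      (contour_integral (linepath (of_real (- R)) (of_real R)) q
      + (contour_integral (linepath (of_real R) a3) q
      + (contour_integral (linepath a3 a4) q + contour_integral (linepath a4 (of_real (- R))) q)))) p"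
    unfolding p_eq using segs far
    by (intro has_contour_integral_join has_contour_integral_integral q_int valid_path_join) auto
  ultimately have total: "of_real pi * f z / of_real (Im z) =
      contour_integral (linepath (of_real (- R)) (of_real R)) q
      + (contour_integral (linepath (of_real R) a3) q
      + (contour_integral (linepath a3 a4) q + contour_integral (linepath a4 (of_real (- R))) q))"
    by (rule has_contour_integral_unique)
  have q_far: "cmod (q w) \<le> 4 * B / R\<^sup>2" if "Im w \<ge> 0" "R \<le> cmod w" for w
  proof -
    \<comment> \<open>From R > 2 |z|: both poles lie within R / 2 of the origin.\<close>
    have "R / 2 \<le> cmod (w - z)" "R / 2 \<le> cmod (w - cnj z)"
      using norm_triangle_ineq2[of w z] norm_triangle_ineq2[of w "cnj z"] that R by auto
    then have "(R / 2) * (R / 2) \<le> cmod (w - cnj z) * cmod (w - z)"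
      using \<open>R > 0\<close> by (intro mult_mono) auto
    then have "cmod (f w) / (cmod (w - cnj z) * cmod (w - z)) \<le> B / ((R / 2) * (R / 2))"
      using bound[OF that(1)] \<open>R > 0\<close> \<open>B \<ge> 0\<close> by (intro frac_le) auto
    then show ?thesis
      by (simp add: q_def norm_divide norm_mult power2_eq_square mult.commute)
  qed
  have seg_bound: "cmod (contour_integral (linepath a b) q) \<le> 4 * B / R\<^sup>2 * cmod (b - a)"
    if "closed_segment a b \<subseteq> {w. Im w \<ge> 0 \<and> R \<le> cmod w}" for a b
  proof (rule has_contour_integral_bound_linepath)
    show "(q has_contour_integral contour_integral (linepath a b) q) (linepath a b)"
      using that far by (intro has_contour_integral_integral q_int) blast
  qed (use that q_far \<open>B \<ge> 0\<close> in auto)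
  have lens: "cmod (a3 - of_real R) = R" "cmod (a4 - a3) = 2 * R" "cmod (of_real (- R) - a4) = R"
    using \<open>R > 0\<close> by (simp_all add: a3_def a4_def cmod_def real_sqrt_mult)
  have "cmod (contour_integral (linepath (of_real R) a3) q
      + (contour_integral (linepath a3 a4) q + contour_integral (linepath a4 (of_real (- R))) q))
      \<le> 4 * B / R\<^sup>2 * R + (4 * B / R\<^sup>2 * (2 * R) + 4 * B / R\<^sup>2 * R)"
    using seg_bound[OF segs(2)] seg_bound[OF segs(3)] seg_bound[OF segs(4)]
    unfolding lens by (intro norm_triangle_le add_mono)
  also have "\<dots> = 16 * B / R"
    using \<open>R > 0\<close> by (simp add: power2_eq_square field_simps)
  finally have rest: "cmod (of_real pi * f z / of_real (Im z) -
      contour_integral (linepath (of_real (- R)) (of_real R)) q) \<le> 16 * B / R"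
    unfolding total by simp
  have q_real: "q (of_real x) = f (of_real x) / of_real ((cmod (of_real x - z))\<^sup>2)" for x
  proof -
    have "(of_real x - cnj z) * (of_real x - z) = of_real ((cmod (of_real x - z))\<^sup>2)"
      using complex_norm_square[of "of_real x - z"] by (simp add: mult.commute)
    then show ?thesis by (simp add: q_def)
  qed
  show "(\<lambda>x. f (of_real x) / of_real ((cmod (of_real x - z))\<^sup>2)) integrable_on {-R..R}"
    using q_int[OF segs(1)] \<open>R > 0\<close> contour_integrable_linepath_Reals_iff[of "of_real (- R)" "of_real R" q]
    by (simp add: q_real)
  have "contour_integral (linepath (of_real (- R)) (of_real R)) q
      = integral {-R..R} (\<lambda>x. f (of_real x) / of_real ((cmod (of_real x - z))\<^sup>2))"
    using \<open>R > 0\<close> contour_integral_linepath_Reals_eq[of "of_real (- R)" "of_real R" q]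
    by (simp add: q_real)
  then show "cmod (integral {-R..R} (\<lambda>x. f (of_real x) / of_real ((cmod (of_real x - z))\<^sup>2))
           - of_real pi * f z / of_real (Im z)) \<le> 16 * B / R"
    using rest by (simp add: norm_minus_commute)
qed

text \<open>The rectangle estimate gives only a limit of integrals over [-n, n]. The sign condition
  makes the integrand nonnegative, so monotone convergence upgrades this limit to a Lebesgue
  integral.\<close>

lemma Poisson_integral_half_plane:
  assumes holf: "f holomorphic_on {w. - d < Im w}" and d: "d > 0"
    and bound: "\<And>w. Im w \<ge> 0 \<Longrightarrow> cmod (f w) \<le> B"
    and nonpos: "\<And>x. Im (f (of_real x)) \<le> 0"
    and z: "Im z > 0"
  shows "has_bochner_integral lborel (\<lambda>x. - Im (f (of_real x)) / (cmod (of_real x - z))\<^sup>2) (pi * - Im (f z) / Im z)"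
proof -
  define p where "p = (\<lambda>x. - Im (f (of_real x)) / (cmod (of_real x - z))\<^sup>2)"
  define F where "F = (\<lambda>x. f (of_real x) / of_real ((cmod (of_real x - z))\<^sup>2))"
  have pF: "p = (\<lambda>x. - Im (F x))"
    by (simp add: p_def F_def)
  have ne: "of_real x \<noteq> z" for x
    using z by auto
  have "continuous_on UNIV (\<lambda>x. f (of_real x))"
    using d by (intro continuous_on_compose2[OF holomorphic_on_imp_continuous_on[OF holf]] continuous_intros) auto
  then have cont_p: "continuous_on A p" for A
    unfolding p_def by (intro continuous_intros) (auto intro: continuous_on_subset simp: ne)
  have int_eq: "(LINT x|lborel. indicator {- R..R} x *\<^sub>R p x) = - Im (integral {- R..R} F)"
    if "F integrable_on {- R..R}" for R
  proof -
    have "(LINT x|lborel. indicator {- R..R} x *\<^sub>R p x) = integral {- R..R} p"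
      using set_borel_integral_eq_integral(2)[OF borel_integrable_atLeastAtMost'[OF cont_p]]
      by (simp add: set_lebesgue_integral_def)
    also have "\<dots> = - integral {- R..R} (Im \<circ> F)"
      by (simp add: pF o_def)
    also have "integral {- R..R} (Im \<circ> F) = Im (integral {- R..R} F)"
      by (rule integral_linear[OF that bounded_linear_Im])
    finally show ?thesis .
  qed
  have "has_bochner_integral lborel p (pi * - Im (f z) / Im z)"
  proof (rule has_bochner_integral_monotone_convergence[where f = "\<lambda>n x. indicator {- real n..real n} x *\<^sub>R p x"])
    show "integrable lborel (\<lambda>x. indicator {- real n..real n} x *\<^sub>R p x)" for n
      using borel_integrable_atLeastAtMost'[OF cont_p] by (simp add: set_integrable_def)
    have "p x \<ge> 0" for x
      using nonpos by (simp add: p_def divide_nonpos_nonneg)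
    then show "AE x in lborel. mono (\<lambda>n. indicator {- real n..real n} x *\<^sub>R p x)"
      by (auto simp: mono_def split: split_indicator)
    show "AE x in lborel. (\<lambda>n. indicator {- real n..real n} x *\<^sub>R p x) \<longlonglongrightarrow> p x"
    proof (rule AE_I2)
      fix x
      have "\<forall>\<^sub>F n in sequentially. p x = indicator {- real n..real n} x *\<^sub>R p x"
        using eventually_ge_at_top[of "nat \<lceil>\<bar>x\<bar>\<rceil>"]
        by eventually_elim (auto simp: nat_le_iff ceiling_le_iff split: split_indicator)
      then show "(\<lambda>n. indicator {- real n..real n} x *\<^sub>R p x) \<longlonglongrightarrow> p x"
        by (rule Lim_transform_eventually[OF tendsto_const])
    qed
    have ev: "\<forall>\<^sub>F n in sequentially. real n > 2 * cmod z"
      using filterlim_real_sequentially by (simp add: filterlim_at_top_dense)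
    have "(\<lambda>n. (LINT x|lborel. indicator {- real n..real n} x *\<^sub>R p x) - pi * - Im (f z) / Im z) \<longlonglongrightarrow> 0"
    proof (rule Lim_null_comparison)
      show "\<forall>\<^sub>F n in sequentially. norm ((LINT x|lborel. indicator {- real n..real n} x *\<^sub>R p x) - pi * - Im (f z) / Im z) \<le> 16 * B / real n"
        using ev
      proof eventually_elim
        case (elim n)
        note est = Poisson_rectangle_estimate[OF holf d bound z elim, folded F_def]
        have "Im (complex_of_real pi * f z / complex_of_real (Im z)) = pi * Im (f z) / Im z"
          by simp
        with int_eq[OF est(1)] have "(LINT x|lborel. indicator {- real n..real n} x *\<^sub>R p x) - pi * - Im (f z) / Im z
            = - Im (integral {- real n..real n} F - complex_of_real pi * f z / complex_of_real (Im z))"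
          by simp
        then show ?case
          using est(2) abs_Im_le_cmod order_trans by (metis abs_minus_cancel real_norm_def)
      qed
      show "(\<lambda>n. 16 * B / real n) \<longlonglongrightarrow> 0"
        by (rule lim_const_over_n)
    qed
    then show "(\<lambda>n. LINT x|lborel. indicator {- real n..real n} x *\<^sub>R p x) \<longlonglongrightarrow> pi * - Im (f z) / Im z"
      by (rule LIM_zero_cancel)
    show "p \<in> borel_measurable lborel"
      using borel_measurable_continuous_onI[OF cont_p] by simp
  qed
  then show ?thesis by (simp add: p_def)
qed

text \<open>When G extends across the real axis, Stieltjes inversion can be read literally: the
  measure has density -Im G / pi. The Poisson formula matches the imaginary parts of G and of the
  transform of this measure; their difference is then a constant, killed by decay along the
  imaginary axis.\<close>

lemma cauchy_transform_exists_regular: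
  assumes holG: "G holomorphic_on {w. - d < Im w}" and d: "d > 0"
    and bound: "\<And>w. Im w \<ge> 0 \<Longrightarrow> cmod (G w) \<le> B"
    and nonpos: "\<And>w. Im w \<ge> 0 \<Longrightarrow> Im (G w) \<le> 0"
    and decay: "\<And>w. Im w > 0 \<Longrightarrow> cmod (G w) \<le> 1 / Im w"
    and mass: "((\<lambda>y. - y * Im (G (\<i> * of_real y))) \<longlongrightarrow> 1) at_top"
  obtains \<nu> where "real_distribution \<nu>" "\<And>z. Im z > 0 \<Longrightarrow> cauchy_transform \<nu> z = G z"
proof -
  define \<rho> where "\<rho> = (\<lambda>x. - Im (G (of_real x)) / pi)"
  have "continuous_on UNIV (\<lambda>x. G (of_real x))"
    using d by (intro continuous_on_compose2[OF holomorphic_on_imp_continuous_on[OF holG]] continuous_intros) auto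
  then have "continuous_on UNIV \<rho>"
    unfolding \<rho>_def by (intro continuous_intros) auto
  then have [measurable]: "\<rho> \<in> borel_measurable borel"
    by (rule borel_measurable_continuous_onI)
  have \<rho>_nonneg: "\<rho> x \<ge> 0" for x
    using nonpos[of "of_real x"] by (simp add: \<rho>_def divide_nonpos_pos)
  have Poisson: "has_bochner_integral lborel (\<lambda>x. \<rho> x / (cmod (of_real x - z))\<^sup>2) (- Im (G z) / Im z)"
    if "Im z > 0" for z
  proof -
    have "has_bochner_integral lborel (\<lambda>x. (1 / pi) * (- Im (G (of_real x)) / (cmod (of_real x - z))\<^sup>2))
        ((1 / pi) * (pi * - Im (G z) / Im z))"
      using that nonpos by (intro has_bochner_integral_mult_right Poisson_integral_half_plane[OF holG d bound]) auto
    then show ?thesis by (simp add: \<rho>_def)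
  qed
  \<comment> \<open>Total mass: y^2 / (x^2 + y^2) increases to 1 as y grows, and the integral of the
    density against it is -y Im G(iy), which tends to 1.\<close>
  have "has_bochner_integral lborel \<rho> 1"
  proof (rule has_bochner_integral_monotone_convergence
      [where f = "\<lambda>n x. (real (Suc n))\<^sup>2 * (\<rho> x / (cmod (of_real x - \<i> * of_real (real (Suc n))))\<^sup>2)"])
    have norm2: "(cmod (of_real x - \<i> * of_real y))\<^sup>2 = x\<^sup>2 + y\<^sup>2" for x y :: real
      by (simp add: cmod_power2)
    have P: "has_bochner_integral lborel (\<lambda>x. y\<^sup>2 * (\<rho> x / (cmod (of_real x - \<i> * of_real y))\<^sup>2))
        (- y * Im (G (\<i> * of_real y)))" if "y > 0" for y
      using has_bochner_integral_mult_right[OF Poisson[of "\<i> * of_real y"], of "y\<^sup>2"] that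
      by (simp add: power2_eq_square)
    show "integrable lborel (\<lambda>x. (real (Suc n))\<^sup>2 * (\<rho> x / (cmod (of_real x - \<i> * of_real (real (Suc n))))\<^sup>2))" for n
      using P[of "real (Suc n)"] by (auto simp: has_bochner_integral_iff)
    have "filterlim (\<lambda>n. real (Suc n)) at_top sequentially"
      using filterlim_compose[OF filterlim_real_sequentially filterlim_Suc] .
    then have "(\<lambda>n. - real (Suc n) * Im (G (\<i> * of_real (real (Suc n))))) \<longlonglongrightarrow> 1"
      by (rule filterlim_compose[OF mass])
    moreover have "(LINT x|lborel. (real (Suc n))\<^sup>2 * (\<rho> x / (cmod (of_real x - \<i> * of_real (real (Suc n))))\<^sup>2))
        = - real (Suc n) * Im (G (\<i> * of_real (real (Suc n))))" for n
      using P[of "real (Suc n)"] by (auto simp: has_bochner_integral_iff)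
    ultimately show "(\<lambda>n. LINT x|lborel. (real (Suc n))\<^sup>2 * (\<rho> x / (cmod (of_real x - \<i> * of_real (real (Suc n))))\<^sup>2)) \<longlonglongrightarrow> 1"
      by (simp only:)
    show "AE x in lborel. mono (\<lambda>n. (real (Suc n))\<^sup>2 * (\<rho> x / (cmod (of_real x - \<i> * of_real (real (Suc n))))\<^sup>2))"
    proof (intro AE_I2 monoI)
      fix x and m n :: nat assume "m \<le> n"
      define a b where "a = (real (Suc m))\<^sup>2" and "b = (real (Suc n))\<^sup>2"
      have ab: "0 < a" "a \<le> b" using \<open>m \<le> n\<close> by (auto simp: a_def b_def intro: power_mono)
      then have "a / (x\<^sup>2 + a) \<le> b / (x\<^sup>2 + b)"
        by (simp add: divide_simps add_nonneg_pos mult_right_mono algebra_simps)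
          (smt (verit) ab mult_left_mono zero_le_power2 add_nonneg_pos)
      then have "\<rho> x * (a / (x\<^sup>2 + a)) \<le> \<rho> x * (b / (x\<^sup>2 + b))"
        using \<rho>_nonneg by (rule mult_left_mono)
      then show "(real (Suc m))\<^sup>2 * (\<rho> x / (cmod (of_real x - \<i> * of_real (real (Suc m))))\<^sup>2)
          \<le> (real (Suc n))\<^sup>2 * (\<rho> x / (cmod (of_real x - \<i> * of_real (real (Suc n))))\<^sup>2)"
        unfolding norm2 a_def b_def by (simp add: mult.commute)
    qed
    show "AE x in lborel. (\<lambda>n. (real (Suc n))\<^sup>2 * (\<rho> x / (cmod (of_real x - \<i> * of_real (real (Suc n))))\<^sup>2)) \<longlonglongrightarrow> \<rho> x"
    proof (rule AE_I2)
      fix x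
      have "(\<lambda>n. \<rho> x / ((x / real (Suc n))\<^sup>2 + 1)) \<longlonglongrightarrow> \<rho> x / (0\<^sup>2 + 1)"
        by (intro tendsto_intros LIMSEQ_Suc[OF lim_const_over_n]) auto
      moreover have "\<rho> x / ((x / real (Suc n))\<^sup>2 + 1) = (real (Suc n))\<^sup>2 * (\<rho> x / (cmod (of_real x - \<i> * of_real (real (Suc n))))\<^sup>2)" for n
      proof -
        have "(x / real (Suc n))\<^sup>2 + 1 = (x\<^sup>2 + (real (Suc n))\<^sup>2) / (real (Suc n))\<^sup>2"
          by (simp add: power_divide add_divide_distrib del: of_nat_Suc)
        then show ?thesis unfolding norm2 by (simp del: of_nat_Suc)
      qed
      ultimately show "(\<lambda>n. (real (Suc n))\<^sup>2 * (\<rho> x / (cmod (of_real x - \<i> * of_real (real (Suc n))))\<^sup>2)) \<longlonglongrightarrow> \<rho> x"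
        by (simp del: of_nat_Suc)
    qed
  qed simp
  then have "(\<integral>\<^sup>+x. ennreal (\<rho> x) \<partial>lborel) = 1"
    using nn_integral_eq_integral[of lborel \<rho>] \<rho>_nonneg by (simp add: has_bochner_integral_iff)
  then have "prob_space (density lborel \<rho>)"
    by (intro prob_spaceI) (simp add: emeasure_density)
  then interpret \<nu>: real_distribution "density lborel \<rho>"
    by (simp add: real_distribution_def real_distribution_axioms_def)
  define D where "D = (\<lambda>z. G z - cauchy_transform (density lborel \<rho>) z)"
  have Im_D: "Im (D z) = 0" if "Im z > 0" for z
  proof -
    have "(LINT s|density lborel \<rho>. 1 / (cmod (z - complex_of_real s))\<^sup>2)
        = (LINT s|lborel. \<rho> s / (cmod (complex_of_real s - z))\<^sup>2)"
      by (subst integral_density) (auto simp: \<rho>_nonneg norm_minus_commute)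
    also have "\<dots> = - Im (G z) / Im z"
      using Poisson[OF that] by (simp add: has_bochner_integral_iff)
    finally show ?thesis
      unfolding D_def using that by (simp add: \<nu>.Im_cauchy_transform(2))
  qed
  have holD: "D holomorphic_on upper_half_plane"
    unfolding D_def using d
    by (intro holomorphic_intros \<nu>.cauchy_transform_holomorphic holomorphic_on_subset[OF holG])
      (auto simp: upper_half_plane_def)
  \<comment> \<open>The difference is real-valued, so the right-hand side of Schwarz--Pick vanishes.\<close>
  have D_const: "D z = D w" if "Im z > 0" "Im w > 0" for z w
  proof -
    have "(cmod (D z - D w))\<^sup>2 * (Im z * Im w) \<le> (cmod (z - w))\<^sup>2 * (Im (D z) * Im (D w))"
      using holD Im_D that by (intro Schwarz_Pick) auto
    then show ?thesis
      using that by (simp add: Im_D mult_le_0_iff)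
  qed
  have "((\<lambda>y. D (\<i> * of_real y)) \<longlongrightarrow> 0 - 0) at_top"
    unfolding D_def
  proof (rule tendsto_diff)
    have inv: "((\<lambda>y::real. 1 / y) \<longlongrightarrow> 0) at_top"
      by (intro tendsto_divide_0[OF tendsto_const] filterlim_at_top_imp_at_infinity filterlim_ident)
    show "((\<lambda>y. G (\<i> * of_real y)) \<longlongrightarrow> 0) at_top"
    proof (rule Lim_null_comparison[OF _ inv])
      show "\<forall>\<^sub>F y in at_top. cmod (G (\<i> * of_real y)) \<le> 1 / y"
        using eventually_gt_at_top[of 0]
      proof eventually_elim
        case (elim y)
        then show ?case using decay[of "\<i> * of_real y"] by simp
      qed
    qed
    have "((\<lambda>y. \<i> * of_real y * cauchy_transform (density lborel \<rho>) (\<i> * of_real y) * (- \<i> * of_real (1 / y))) \<longlongrightarrow> 1 * (- \<i> * of_real 0)) at_top"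
      by (intro tendsto_intros \<nu>.cauchy_transform_vertical_limit inv)
    then have "((\<lambda>y. \<i> * of_real y * cauchy_transform (density lborel \<rho>) (\<i> * of_real y) * (- \<i> * of_real (1 / y))) \<longlongrightarrow> 0) at_top"
      by simp
    moreover have "\<forall>\<^sub>F y in at_top. \<i> * of_real y * cauchy_transform (density lborel \<rho>) (\<i> * of_real y) * (- \<i> * of_real (1 / y))
        = cauchy_transform (density lborel \<rho>) (\<i> * of_real y)"
      using eventually_gt_at_top[of 0] by eventually_elim (simp add: mult_ac)
    ultimately show "((\<lambda>y. cauchy_transform (density lborel \<rho>) (\<i> * of_real y)) \<longlongrightarrow> 0) at_top"
      by (rule Lim_transform_eventually)
  qed
  then have D_lim: "((\<lambda>y. D (\<i> * of_real y)) \<longlongrightarrow> 0) at_top" by simp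
  have "D z = 0" if z: "Im z > 0" for z
  proof -
    have "\<forall>\<^sub>F y in at_top. D (\<i> * of_real y) = D z"
      using eventually_gt_at_top[of 0] by eventually_elim (rule D_const; simp add: z)
    from Lim_transform_eventually[OF D_lim this] show ?thesis
      by (simp add: tendsto_const_iff)
  qed
  then show ?thesis
    using that[of "density lborel \<rho>"] \<nu>.real_distribution_axioms by (simp add: D_def)
qed

text \<open>The function -1 + 2 y^2 / (s^2 + y^2) lies below the indicator of the interval: it never
  exceeds 1 and is nonpositive for |s| \<ge> y. Its integral is the left-hand side; the bound
  supplies tightness.\<close>

lemma (in real_distribution) prob_Ioc_ge_cauchy_transform:
  assumes "y > 0"
  shows "- 1 - 2 * y * Im (cauchy_transform M (\<i> * of_real y)) \<le> prob {- y<..y}"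
proof -
  have norm2: "(cmod (\<i> * of_real y - of_real s))\<^sup>2 = s\<^sup>2 + y\<^sup>2" for s
    by (simp add: cmod_power2)
  have int: "integrable M (\<lambda>s. 1 / (s\<^sup>2 + y\<^sup>2))"
    using Im_cauchy_transform(1)[of "\<i> * of_real y"] assms by (simp add: norm2)
  have "Im (cauchy_transform M (\<i> * of_real y)) = - y * (LINT s|M. 1 / (s\<^sup>2 + y\<^sup>2))"
    using Im_cauchy_transform(2)[of "\<i> * of_real y"] assms by (simp add: norm2)
  moreover have "(LINT s|M. - 1 + 2 * y\<^sup>2 * (1 / (s\<^sup>2 + y\<^sup>2))) = - 1 + 2 * y\<^sup>2 * (LINT s|M. 1 / (s\<^sup>2 + y\<^sup>2))"
    using int prob_space by (simp del: times_divide_eq_right)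
  ultimately have "- 1 - 2 * y * Im (cauchy_transform M (\<i> * of_real y)) = (LINT s|M. - 1 + 2 * y\<^sup>2 * (1 / (s\<^sup>2 + y\<^sup>2)))"
    by (simp add: power2_eq_square)
  also have "\<dots> \<le> (LINT s|M. indicator {- y<..y} s)"
  proof (rule integral_mono)
    show "integrable M (\<lambda>s. - 1 + 2 * y\<^sup>2 * (1 / (s\<^sup>2 + y\<^sup>2)))"
      using int by (intro Bochner_Integration.integrable_add integrable_mult_right) auto
    show "- 1 + 2 * y\<^sup>2 * (1 / (s\<^sup>2 + y\<^sup>2)) \<le> indicator {- y<..y} s" for s
    proof (cases "s \<in> {- y<..y}")
      case True
      have "y\<^sup>2 * (1 / (s\<^sup>2 + y\<^sup>2)) \<le> 1"
        using assms by (simp add: divide_le_eq_1 add_nonneg_pos)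
      then show ?thesis using True by simp
    next
      case False
      then have "\<bar>y\<bar> \<le> \<bar>s\<bar>" using assms by auto
      then have "y\<^sup>2 \<le> s\<^sup>2" by (simp add: abs_le_square_iff)
      then show ?thesis using False assms by (simp add: divide_le_eq_1 add_nonneg_pos pos_divide_le_eq)
    qed
  qed (rule integrable_real_indicator, simp, simp add: emeasure_eq_measure)
  finally show ?thesis by simp
qed

text \<open>Shifting G by \<open>\<i> * e\<close> makes it regular on the real axis. The resulting
  measures are tight, and a weak limit along a subsequence has transform G because the Cauchy kernel
  is bounded and continuous in s.\<close>

theorem cauchy_transform_exists:
  assumes holG: "G holomorphic_on upper_half_plane"
    and nonpos: "\<And>w. Im w > 0 \<Longrightarrow> Im (G w) \<le> 0"
    and decay: "\<And>w. Im w > 0 \<Longrightarrow> cmod (G w) \<le> 1 / Im w"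
    and mass: "((\<lambda>y. - y * Im (G (\<i> * of_real y))) \<longlongrightarrow> 1) at_top"
  obtains \<nu> where "real_distribution \<nu>" "\<And>z. Im z > 0 \<Longrightarrow> cauchy_transform \<nu> z = G z"
proof -
  have "\<exists>\<nu>. real_distribution \<nu> \<and> (\<forall>z. Im z > 0 \<longrightarrow> cauchy_transform \<nu> z = G (z + \<i> * of_real e))"
    if e: "e > 0" for e
  proof (rule cauchy_transform_exists_regular[of "\<lambda>z. G (z + \<i> * of_real e)" e "1 / e"])
    have "G \<circ> (\<lambda>z. z + \<i> * of_real e) holomorphic_on {w. - e < Im w}"
      by (rule holomorphic_on_compose_gen[OF _ holG]) (auto intro!: holomorphic_intros)
    then show "(\<lambda>z. G (z + \<i> * of_real e)) holomorphic_on {w. - e < Im w}"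
      by (simp add: o_def)
    show "cmod (G (w + \<i> * of_real e)) \<le> 1 / e" if "Im w \<ge> 0" for w
    proof -
      have "cmod (G (w + \<i> * of_real e)) \<le> 1 / (Im w + e)"
        using decay[of "w + \<i> * of_real e"] that e by simp
      also have "\<dots> \<le> 1 / e" using that e by (intro divide_left_mono) auto
      finally show ?thesis .
    qed
    show "cmod (G (w + \<i> * of_real e)) \<le> 1 / Im w" if "Im w > 0" for w
    proof -
      have "cmod (G (w + \<i> * of_real e)) \<le> 1 / (Im w + e)"
        using decay[of "w + \<i> * of_real e"] that e by simp
      also have "\<dots> \<le> 1 / Im w" using that e by (intro divide_left_mono) auto
      finally show ?thesis .
    qed
    have shift: "filterlim (\<lambda>y. e + y) at_top at_top"
      by (rule filterlim_tendsto_add_at_top[OF tendsto_const filterlim_ident])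
    \<comment> \<open>The mass condition is known at height e + y; the factor 1 - e / (e + y) = y /
      (e + y) converts its weight to y.\<close>
    have "((\<lambda>y. (1 - e / (e + y)) * (- (e + y) * Im (G (\<i> * of_real (e + y))))) \<longlongrightarrow> (1 - 0) * 1) at_top"
      by (intro tendsto_mult tendsto_diff tendsto_const filterlim_compose[OF mass shift]
          tendsto_divide_0[OF tendsto_const] filterlim_at_top_imp_at_infinity shift)
    moreover have "\<forall>\<^sub>F y in at_top. (1 - e / (e + y)) * (- (e + y) * Im (G (\<i> * of_real (e + y))))
        = - y * Im (G (\<i> * of_real y + \<i> * of_real e))"
      using eventually_gt_at_top[of 0]
    proof eventually_elim
      case (elim y)
      then have "(1 - e / (e + y)) * (e + y) = y" using e by (simp add: field_simps)
      moreover have "\<i> * of_real (e + y) = \<i> * of_real y + \<i> * of_real e" by (simp add: distrib_left)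
      ultimately show ?case by (simp only: mult_minus_left mult_minus_right mult.assoc[symmetric])
    qed
    ultimately show "((\<lambda>y. - y * Im (G (\<i> * of_real y + \<i> * of_real e))) \<longlongrightarrow> 1) at_top"
      using Lim_transform_eventually by fastforce
  qed (use nonpos e in auto)
  then obtain N where N: "\<And>e. e > 0 \<Longrightarrow> real_distribution (N e)"
    "\<And>e z. e > 0 \<Longrightarrow> Im z > 0 \<Longrightarrow> cauchy_transform (N e) z = G (z + \<i> * of_real e)"
    by metis
  define \<mu> where "\<mu> = (\<lambda>n. N (1 / real (Suc n)))"
  have \<mu>: "real_distribution (\<mu> n)" for n
    unfolding \<mu>_def by (rule N) simp
  have G_\<mu>: "cauchy_transform (\<mu> n) z = G (z + \<i> * of_real (1 / real (Suc n)))" if "Im z > 0" for n z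
    unfolding \<mu>_def by (rule N(2)) (use that in auto)
  have "tight \<mu>"
    unfolding tight_def
  proof (intro conjI allI impI \<mu>)
    fix \<epsilon> :: real assume "\<epsilon> > 0"
    \<comment> \<open>One \<delta> is lost to the mass condition and one to the shift e;
      \<open>prob_Ioc_ge_cauchy_transform\<close> doubles the loss, giving 4 \<delta> =
      \<epsilon>.\<close>
    define \<delta> where "\<delta> = \<epsilon> / 4"
    have "\<delta> > 0" using \<open>\<epsilon> > 0\<close> by (simp add: \<delta>_def)
    have "\<forall>\<^sub>F y in at_top. - y * Im (G (\<i> * of_real y)) > 1 - \<delta>"
      using order_tendstoD(1)[OF mass] \<open>\<delta> > 0\<close> by simp
    then obtain Y where Y: "\<And>y. y \<ge> Y \<Longrightarrow> - y * Im (G (\<i> * of_real y)) > 1 - \<delta>"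
      by (auto simp: eventually_at_top_linorder)
    \<comment> \<open>With 1 / y \<le> \<delta>, decay gives q \<le> \<delta>, so the shift e \<le>
      1 costs at most \<delta>, uniformly in n.\<close>
    define y where "y = max Y (1 / \<delta>)"
    have y: "y \<ge> Y" "y > 0" "1 / y \<le> \<delta>"
    proof -
      show "y \<ge> Y" "y > 0" using \<open>\<delta> > 0\<close> by (auto simp: y_def intro: less_max_iff_disj[THEN iffD2])
      have "1 / \<delta> \<le> y" by (simp add: y_def)
      then show "1 / y \<le> \<delta>" using \<open>\<delta> > 0\<close> \<open>y > 0\<close> by (simp add: field_simps)
    qed
    have "measure (\<mu> n) {- y<..y} > 1 - \<epsilon>" for n
    proof -
      interpret real_distribution "\<mu> n" by (rule \<mu>)
      define e where "e = 1 / real (Suc n)"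
      have e: "0 < e" "e \<le> 1" by (auto simp: e_def)
      define q where "q = - Im (G (\<i> * of_real (y + e)))"
      have q: "1 - \<delta> < (y + e) * q" 
      proof -
        have "Y \<le> y + e" using y e by simp
        from Y[OF this] show ?thesis by (simp only: q_def mult_minus_left mult_minus_right)
      qed
      have "cmod (G (\<i> * of_real (y + e))) \<le> 1 / (y + e)"
        using decay[of "\<i> * of_real (y + e)"] y e by simp
      then have "q \<le> 1 / (y + e)"
        using abs_Im_le_cmod[of "G (\<i> * of_real (y + e))"] by (simp add: q_def)
      also have "\<dots> \<le> 1 / y" using y e by (intro divide_left_mono) auto
      finally have "q \<le> \<delta>" using y by simp
      have "e * q \<le> \<delta>"
      proof (cases "q \<ge> 0")
        case True
        then have "e * q \<le> 1 * q" using e by (intro mult_right_mono) auto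
        then show ?thesis using \<open>q \<le> \<delta>\<close> by simp
      next
        case False
        then show ?thesis using e \<open>\<delta> > 0\<close> by (smt (verit) mult_pos_neg)
      qed
      then have "1 - 2 * \<delta> < y * q" using q by (simp add: distrib_right)
      then have "1 - \<epsilon> < - 1 - 2 * y * Im (cauchy_transform (\<mu> n) (\<i> * of_real y))"
        using y by (simp add: G_\<mu> q_def \<delta>_def e_def distrib_left)
      also have "\<dots> \<le> prob {- y<..y}"
        by (rule prob_Ioc_ge_cauchy_transform) fact
      finally show ?thesis .
    qed
    then show "\<exists>a b. a < b \<and> (\<forall>n. 1 - \<epsilon> < measure (\<mu> n) {a<..b})"
      using y by (intro exI[of _ "- y"] exI[of _ y]) auto
  qed
  from tight_imp_convergent_subsubsequence[OF this strict_mono_id]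
  obtain r \<nu> where r: "strict_mono (r :: nat \<Rightarrow> nat)" and \<nu>: "real_distribution \<nu>"
    and conv: "weak_conv_m (\<mu> \<circ> id \<circ> r) \<nu>" by auto
  interpret \<nu>: real_distribution \<nu> by (rule \<nu>)
  have "cauchy_transform \<nu> z = G z" if z: "Im z > 0" for z
  proof (rule LIMSEQ_unique)
    have ne: "z - of_real s \<noteq> 0" for s using z by auto
    have "(\<lambda>n. LINT s|(\<mu> \<circ> id \<circ> r) n. 1 / (z - complex_of_real s)) \<longlonglongrightarrow> (LINT s|\<nu>. 1 / (z - complex_of_real s))"
    proof (rule weak_conv_imp_integral_bdd_continuous_conv[OF _ \<nu> conv])
      show "isCont (\<lambda>s. 1 / (z - complex_of_real s)) x" for x
        using ne by (intro continuous_intros) auto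
      show "cmod (1 / (z - complex_of_real x)) \<le> 1 / Im z" for x
        using \<nu>.cauchy_kernel_bound[OF z order_refl, of x 1] by simp
    qed (simp add: \<mu>)
    then show "(\<lambda>n. cauchy_transform (\<mu> (r n)) z) \<longlonglongrightarrow> cauchy_transform \<nu> z"
      by (simp add: cauchy_transform_def)
    have "(\<lambda>n. z + \<i> * of_real (1 / real (Suc n))) \<longlonglongrightarrow> z + \<i> * of_real 0"
      by (intro tendsto_intros LIMSEQ_Suc[OF lim_1_over_n])
    then have "(\<lambda>n. z + \<i> * of_real (1 / real (Suc n))) \<longlonglongrightarrow> z" by simp
    then have "(\<lambda>n. z + \<i> * of_real (1 / real (Suc (r n)))) \<longlonglongrightarrow> z"
      using LIMSEQ_subseq_LIMSEQ[OF _ r] by (simp add: o_def)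
    moreover have "isCont G z"
      using holG z open_upper_half_plane
      by (intro continuous_on_interior[OF holomorphic_on_imp_continuous_on]) (auto simp: interior_open)
    ultimately have "(\<lambda>n. G (z + \<i> * of_real (1 / real (Suc (r n))))) \<longlonglongrightarrow> G z"
      by (rule isCont_tendsto_compose[rotated])
    then show "(\<lambda>n. cauchy_transform (\<mu> (r n)) z) \<longlonglongrightarrow> G z"
      by (simp only: G_\<mu>[OF z])
  qed
  then show ?thesis using that \<nu> by blast
qed

section \<open>Inverses near infinity\<close>

context pick_perturbation
begin

text \<open>For G = 1 / (z + g z), the bound \<open>Im z \<le> Im (z + g z)\<close> yields both the
  sign and the decay of G, and \<open>vertical_limit\<close> yields total mass 1.\<close>

theorem representing_measure_exists:
  obtains \<nu> where "real_distribution \<nu>" "\<And>z. Im z > 0 \<Longrightarrow> recip_cauchy_transform \<nu> z = z + g z"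
proof -
  have Im_le: "Im z \<le> Im (z + g z)" if "Im z > 0" for z
    using Im_nonneg[OF that] by simp
  have ne: "z + g z \<noteq> 0" if "Im z > 0" for z
    using Im_le[OF that] that by (metis leD zero_complex.simps(2))
  obtain \<nu> where \<nu>: "real_distribution \<nu>" "\<And>z. Im z > 0 \<Longrightarrow> cauchy_transform \<nu> z = 1 / (z + g z)"
  proof (rule cauchy_transform_exists[of "\<lambda>z. 1 / (z + g z)"])
    show "(\<lambda>z. 1 / (z + g z)) holomorphic_on upper_half_plane"
      using ne by (intro holomorphic_intros holomorphic) auto
    show "Im (1 / (w + g w)) \<le> 0" if "Im w > 0" for w
      using Im_le[OF that] that by (auto simp: Im_divide intro!: divide_nonpos_nonneg)
    show "cmod (1 / (w + g w)) \<le> 1 / Im w" if "Im w > 0" for w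
      using Im_le[OF that] that abs_Im_le_cmod[of "w + g w"] by (simp add: norm_divide frac_le)
    have "((\<lambda>y. Re (1 / (1 - \<i> * (g (\<i> * of_real y) / of_real y)))) \<longlongrightarrow> Re (1 / (1 - \<i> * 0))) at_top"
      by (intro tendsto_intros vertical_limit) auto
    then have "((\<lambda>y. Re (1 / (1 - \<i> * (g (\<i> * of_real y) / of_real y)))) \<longlongrightarrow> 1) at_top"
      by simp
    moreover have "\<forall>\<^sub>F y in at_top. Re (1 / (1 - \<i> * (g (\<i> * of_real y) / of_real y)))
        = - y * Im (1 / (\<i> * of_real y + g (\<i> * of_real y)))"
      using eventually_gt_at_top[of 0]
    proof eventually_elim
      case (elim y)
      have "\<i> * of_real y + g (\<i> * of_real y) = \<i> * of_real y * (1 - \<i> * (g (\<i> * of_real y) / of_real y))"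
        using elim by (simp add: field_simps)
      then have "1 / (1 - \<i> * (g (\<i> * of_real y) / of_real y)) = \<i> * of_real y * (1 / (\<i> * of_real y + g (\<i> * of_real y)))"
        using elim by simp
      moreover have "Re (\<i> * of_real y * x) = - y * Im x" for x by simp
      ultimately show ?case by (simp only:)
    qed
    ultimately show "((\<lambda>y. - y * Im (1 / (\<i> * of_real y + g (\<i> * of_real y)))) \<longlongrightarrow> 1) at_top"
      by (rule Lim_transform_eventually)
  qed blast
  then show ?thesis
    using that[of \<nu>] by (simp add: recip_cauchy_transform_def)
qed

text \<open>Schwarz--Pick is applied to w and the point of the imaginary axis at the same height,
  giving r^2 \<le> \<alpha>^2 x m. The arithmetic-geometric mean inequality gives r \<le> (x +
  \<alpha>^2 m) / 2, and x \<le> m + r absorbs the x / 2.\<close>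

lemma cone_bound:
  assumes "Im w > 0" "\<bar>Re w\<bar> \<le> \<alpha> * Im w"
  shows "cmod (g w) \<le> (2 + \<alpha>\<^sup>2) * cmod (g (\<i> * of_real (Im w)))"
proof -
  let ?b = "\<i> * of_real (Im w)"
  define x m r where "x = cmod (g w)" "m = cmod (g ?b)" "r = cmod (g w - g ?b)"
  note defs = this
  have "x \<ge> 0" "m \<ge> 0" "r \<ge> 0" by (auto simp: defs)
  have "w - ?b = of_real (Re w)" by (simp add: complex_eq_iff)
  then have "r\<^sup>2 * (Im w * Im w) \<le> \<bar>Re w\<bar>\<^sup>2 * (Im (g w) * Im (g ?b))"
    using Schwarz_Pick[OF holomorphic Im_nonneg, of w ?b] assms by (simp add: defs)
  also have "\<dots> \<le> (\<alpha> * Im w)\<^sup>2 * (x * m)"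
    using assms Im_nonneg[of w] Im_nonneg[of ?b] abs_Im_le_cmod[of "g w"] abs_Im_le_cmod[of "g ?b"]
    by (intro mult_mono power_mono) (auto simp: defs)
  finally have "r\<^sup>2 * (Im w * Im w) \<le> (\<alpha>\<^sup>2 * (x * m)) * (Im w * Im w)"
    by (simp add: power2_eq_square mult_ac)
  then have "r\<^sup>2 \<le> \<alpha>\<^sup>2 * (x * m)"
    using assms by (simp add: mult_le_cancel_right_pos)
  also have "\<dots> \<le> ((x + \<alpha>\<^sup>2 * m) / 2)\<^sup>2"
    using zero_le_power2[of "x - \<alpha>\<^sup>2 * m"] by (simp add: power2_eq_square field_simps)
  finally have "r \<le> (x + \<alpha>\<^sup>2 * m) / 2"
    by (rule power2_le_imp_le) (use \<open>x \<ge> 0\<close> \<open>m \<ge> 0\<close> in simp)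
  moreover have "x \<le> m + r"
    unfolding defs by (rule norm_triangle_sub)
  ultimately show ?thesis
    unfolding defs(1,2)[symmetric] by (simp add: distrib_right)
qed

lemma cone_small:
  assumes "e > 0"
  shows "\<exists>\<beta>>0. \<forall>w. Im w > \<beta> \<longrightarrow> \<bar>Re w\<bar> \<le> 2 * Im w \<longrightarrow> cmod (g w) \<le> e * Im w"
proof -
  \<comment> \<open>The 6 is 2 + \<alpha>^2 from \<open>cone_bound\<close> at \<alpha> = 2.\<close>
  have "\<forall>\<^sub>F y in at_top. y > 0 \<and> cmod (g (\<i> * complex_of_real y)) \<le> e / 6 * y"
    using assms by (intro small_on_imaginary_axis) simp
  then obtain Y where Y: "\<And>y. y \<ge> Y \<Longrightarrow> cmod (g (\<i> * complex_of_real y)) \<le> e / 6 * y"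
    by (auto simp: eventually_at_top_linorder)
  have "cmod (g w) \<le> e * Im w" if w: "Im w > max Y 1" "\<bar>Re w\<bar> \<le> 2 * Im w" for w
  proof -
    have "Im w > 0" "Im w \<ge> Y" using w(1) by auto
    then show ?thesis
      using cone_bound[OF \<open>Im w > 0\<close> w(2)] Y[of "Im w"] by simp
  qed
  then show ?thesis by (intro exI[of _ "max Y 1"]) auto
qed

text \<open>Where |g| is at most e times the height, g has Lipschitz constant e < 1, so it cannot
  cancel the identity.\<close>

lemma perturbed_injective:
  assumes small: "\<And>w. Im w > \<beta> \<Longrightarrow> \<bar>Re w\<bar> \<le> 2 * Im w \<Longrightarrow> cmod (g w) \<le> e * Im w"
    and "e < 1" "\<beta> > 0"
    and a: "Im a > \<beta>" "\<bar>Re a\<bar> \<le> 2 * Im a" and b: "Im b > \<beta>" "\<bar>Re b\<bar> \<le> 2 * Im b"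
    and eq: "a + g a = b + g b"
  shows "a = b"
proof -
  have pos: "Im a > 0" "Im b > 0" using a b \<open>\<beta> > 0\<close> by auto
  have le: "Im (g a) \<le> e * Im a" "Im (g b) \<le> e * Im b"
    using small[OF a] small[OF b] abs_Im_le_cmod[of "g a"] abs_Im_le_cmod[of "g b"] by auto
  have "0 \<le> e * Im a" using small[OF a] norm_ge_zero order_trans by blast
  then have "e \<ge> 0" using pos by (simp add: zero_le_mult_iff)
  have "Im (g a) * Im (g b) \<le> (e * Im a) * (e * Im b)"
    using le pos Im_nonneg \<open>e \<ge> 0\<close> by (intro mult_mono) auto
  then have "cmod (g a - g b) \<le> e * cmod (a - b)"
    using pos \<open>e \<ge> 0\<close> by (intro lipschitz_bound) (auto simp: power2_eq_square mult_ac)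
  moreover have "g a - g b = b - a" using eq by (simp add: algebra_simps)
  ultimately have "cmod (a - b) \<le> e * cmod (a - b)" by (simp add: norm_minus_commute)
  then have "(1 - e) * cmod (a - b) \<le> 0" by (simp add: algebra_simps)
  then show ?thesis using \<open>e < 1\<close> by (simp add: mult_le_0_iff)
qed

text \<open>A solution is a fixed point of \<open>z - g w\<close>, found by Brouwer on a disc around
  z. With e \<le> 1/8 the radius 2 e Im z is at most Im z / 4; this keeps the disc in the wider cone
  of aperture 2 and below height 2 Im z, where |g| is at most the radius.\<close>

lemma perturbed_solution:
  assumes small: "\<And>w. Im w > \<beta> \<Longrightarrow> \<bar>Re w\<bar> \<le> 2 * Im w \<Longrightarrow> cmod (g w) \<le> e * Im w"
    and "0 < e" "e \<le> 1 / 8" "\<beta> > 0"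
    and z: "Im z > 2 * \<beta>" "\<bar>Re z\<bar> < Im z"
  shows "\<exists>w. Im w > \<beta> \<and> \<bar>Re w\<bar> < 2 * Im w \<and> w + g w = z \<and> cmod (w - z) \<le> 2 * e * Im z"
proof -
  define r where "r = 2 * e * Im z"
  have "Im z > 0" using z \<open>\<beta> > 0\<close> by simp
  then have r: "r > 0" "r \<le> Im z / 4" using assms by (auto simp: r_def)
  have in_ball: "Im w > \<beta> \<and> \<bar>Re w\<bar> < 2 * Im w \<and> Im w \<le> 2 * Im z" if "w \<in> cball z r" for w
  proof -
    have "cmod (w - z) \<le> Im z / 4" using that r by (simp add: dist_norm norm_minus_commute)
    then have "\<bar>Re w - Re z\<bar> \<le> Im z / 4" "\<bar>Im w - Im z\<bar> \<le> Im z / 4"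
      using abs_Re_le_cmod[of "w - z"] abs_Im_le_cmod[of "w - z"] by auto
    then show ?thesis using z \<open>Im z > 0\<close> by linarith
  qed
  have "cball z r \<subseteq> upper_half_plane" using in_ball \<open>\<beta> > 0\<close> by force
  then have "continuous_on (cball z r) (\<lambda>w. z - g w)"
    by (intro continuous_intros continuous_on_subset[OF holomorphic_on_imp_continuous_on[OF holomorphic]])
  moreover have "(\<lambda>w. z - g w) \<in> cball z r \<rightarrow> cball z r"
  proof
    fix w assume "w \<in> cball z r"
    from in_ball[OF this] have w: "Im w > \<beta>" "\<bar>Re w\<bar> \<le> 2 * Im w" "Im w \<le> 2 * Im z" by auto
    have "cmod (g w) \<le> e * (2 * Im z)"
      using small[OF w(1,2)] w(3) \<open>0 < e\<close> by (meson mult_left_mono order_trans less_imp_le)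
    then show "z - g w \<in> cball z r" by (simp add: dist_norm r_def mult_ac)
  qed
  ultimately obtain w where w: "w \<in> cball z r" "z - g w = w"
    using brouwer_ball[OF r(1)] by blast
  then have "w + g w = z" "cmod (w - z) \<le> 2 * e * Im z"
    by (auto simp: dist_norm norm_minus_commute r_def algebra_simps)
  then show ?thesis using in_ball[OF w(1)] by blast
qed

text \<open>The last condition on the values of \<open>\<Phi>\<close> puts them into the range of \<open>subordination t\<close>.\<close>

lemma cone_inverse_exists:
  assumes "t \<ge> 0"
  obtains \<Phi> \<beta> where "\<beta> > 0" "\<Phi> holomorphic_on truncated_cone 1 \<beta>"
    "\<And>z. z \<in> truncated_cone 1 \<beta> \<Longrightarrow> Im (\<Phi> z) > 0 \<and> \<Phi> z + g (\<Phi> z) = z \<and> Im (\<Phi> z - of_real t * g (\<Phi> z)) > 0"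
    "((\<lambda>z. \<Phi> z / z) \<longlongrightarrow> 1) (inf at_infinity (principal (truncated_cone 1 \<beta>)))"
proof -
  \<comment> \<open>The 8 serves \<open>perturbed_solution\<close>; the factor 1 + t gives t e < 1,
    hence positive imaginary part of \<open>w - t g(w)\<close>.\<close>
  define e where "e = 1 / (8 * (1 + t))"
  have e: "0 < e" "e \<le> 1 / 8" "t * e < 1"
    using assms by (auto simp: e_def divide_simps)
  obtain \<beta> where \<beta>: "\<beta> > 0"
    and small: "\<And>w. Im w > \<beta> \<Longrightarrow> \<bar>Re w\<bar> \<le> 2 * Im w \<Longrightarrow> cmod (g w) \<le> e * Im w"
    using cone_small[OF e(1)] by blast
  define E where "E = {w. Im w > \<beta> \<and> \<bar>Re w\<bar> < 2 * Im w}"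
  have "E \<subseteq> upper_half_plane" using \<beta> by (auto simp: E_def)
  then have hol: "(\<lambda>w. w + g w) holomorphic_on E"
    by (intro holomorphic_intros holomorphic_on_subset[OF holomorphic])
  have "open E"
    unfolding E_def by (intro open_Collect_conj open_Collect_less continuous_intros)
  have inj: "inj_on (\<lambda>w. w + g w) E"
    by (rule inj_onI, rule perturbed_injective[where \<beta> = \<beta> and e = e])
      (use small e \<beta> in \<open>auto simp: E_def\<close>)
  obtain \<Phi> where \<Phi>: "\<Phi> holomorphic_on (\<lambda>w. w + g w) ` E" "\<And>w. w \<in> E \<Longrightarrow> \<Phi> (w + g w) = w"
    using holomorphic_has_inverse[OF hol \<open>open E\<close> inj] by metis
  have sol: "\<exists>w\<in>E. w + g w = z" if "z \<in> truncated_cone 1 (2 * \<beta>)" for z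
    using perturbed_solution[OF small e(1,2) \<beta>, of z] that by (auto simp: truncated_cone_def E_def)
  show ?thesis
  proof (rule that[of "2 * \<beta>" \<Phi>])
    show "2 * \<beta> > 0" using \<beta> by simp
    show "\<Phi> holomorphic_on truncated_cone 1 (2 * \<beta>)"
      using sol by (intro holomorphic_on_subset[OF \<Phi>(1)]) blast
    show "Im (\<Phi> z) > 0 \<and> \<Phi> z + g (\<Phi> z) = z \<and> Im (\<Phi> z - of_real t * g (\<Phi> z)) > 0"
      if z: "z \<in> truncated_cone 1 (2 * \<beta>)" for z
    proof -
      obtain w where w: "w \<in> E" "w + g w = z" using sol[OF z] by blast
      then have "\<Phi> z = w" using \<Phi>(2) by blast
      have "Im w > 0" using w(1) \<beta> by (simp add: E_def)
      have "Im (g w) \<le> e * Im w"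
        using small[of w] w(1) abs_Im_le_cmod[of "g w"] by (simp add: E_def)
      then have "t * Im (g w) \<le> t * (e * Im w)"
        using assms by (rule mult_left_mono)
      also have "\<dots> < Im w"
        using e(3) \<open>Im w > 0\<close> by (simp add: mult.assoc[symmetric])
      finally show ?thesis
        using \<open>\<Phi> z = w\<close> w(2) \<open>Im w > 0\<close> by simp
    qed
    show "((\<lambda>z. \<Phi> z / z) \<longlongrightarrow> 1) (inf at_infinity (principal (truncated_cone 1 (2 * \<beta>))))"
    proof (rule tendstoI)
      fix \<epsilon> :: real assume "\<epsilon> > 0"
      \<comment> \<open>The equation is solved again with a finer tolerance. Because
        \<open>B\<close> is at least \<open>\<beta>\<close>, the new solution lies in
        \<open>E\<close>, where it must coincide with \<open>\<Phi> z\<close>; so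
        \<open>\<Phi>\<close> inherits the sharper bound.\<close>
      define e' where "e' = min e (\<epsilon> / 4)"
      have e': "0 < e'" "e' \<le> 1 / 8" "2 * e' < \<epsilon>" using e \<open>\<epsilon> > 0\<close> by (auto simp: e'_def)
      obtain \<gamma> where \<gamma>: "\<gamma> > 0"
        and small': "\<And>w. Im w > \<gamma> \<Longrightarrow> \<bar>Re w\<bar> \<le> 2 * Im w \<Longrightarrow> cmod (g w) \<le> e' * Im w"
        using cone_small[OF e'(1)] by blast
      define B where "B = max \<beta> \<gamma>"
      \<comment> \<open>In the cone |z| < 2 Im z, so |z| \<ge> 4 B + 1 forces Im z > 2 B.\<close>
      have "dist (\<Phi> z / z) 1 < \<epsilon>" if "4 * B + 1 \<le> cmod z" "z \<in> truncated_cone 1 (2 * \<beta>)" for z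
      proof -
        have z: "\<bar>Re z\<bar> < Im z" using that(2) by (simp add: truncated_cone_def)
        then have "Im z > 2 * B" using cmod_le[of z] that(1) by linarith
        moreover have "B > 0" using \<beta> by (simp add: B_def)
        ultimately obtain w where w: "Im w > B" "\<bar>Re w\<bar> < 2 * Im w" "w + g w = z" "cmod (w - z) \<le> 2 * e' * Im z"
          using perturbed_solution[of B e' z, OF small' e'(1,2)] z by (auto simp: B_def)
        then have "\<Phi> z = w" using \<Phi>(2)[of w] by (simp add: E_def B_def)
        have "z \<noteq> 0" using \<open>Im z > 2 * B\<close> \<open>B > 0\<close> by auto
        have "dist (\<Phi> z / z) 1 = cmod (w - z) / cmod z"
          using \<open>z \<noteq> 0\<close> \<open>\<Phi> z = w\<close> by (simp add: dist_norm diff_divide_distrib norm_divide[symmetric])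
        also have "\<dots> \<le> 2 * e' * Im z / cmod z"
          using w(4) by (intro divide_right_mono) auto
        also have "\<dots> \<le> 2 * e' * cmod z / cmod z"
          using e'(1) abs_Im_le_cmod[of z] by (intro divide_right_mono mult_left_mono) auto
        also have "\<dots> < \<epsilon>" using \<open>z \<noteq> 0\<close> e'(3) by simp
        finally show ?thesis .
      qed
      then show "\<forall>\<^sub>F z in inf at_infinity (principal (truncated_cone 1 (2 * \<beta>))). dist (\<Phi> z / z) 1 < \<epsilon>"
        unfolding eventually_inf_principal eventually_at_infinity by blast
    qed
  qed
qed

end

section \<open>Free and Boolean convolution powers\<close>

lemma right_inverse_vertical_limit:
  assumes "is_right_inverse_on_cone \<mu> \<alpha> \<beta> \<Phi>" "\<alpha> > 0"
  shows "((\<lambda>y. \<Phi> (\<i> * of_real y) / (\<i> * of_real y)) \<longlongrightarrow> 1) at_top"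
proof -
  have "filterlim (\<lambda>y. \<i> * complex_of_real y) at_infinity at_top"
    unfolding filterlim_at_infinity_conv_norm_at_top
    using filterlim_abs_real by (simp add: norm_mult)
  moreover have "\<forall>\<^sub>F y in at_top. \<i> * complex_of_real y \<in> truncated_cone \<alpha> \<beta>"
    using eventually_gt_at_top[of 0] eventually_gt_at_top[of \<beta>]
    by eventually_elim (use \<open>\<alpha> > 0\<close> in \<open>simp add: truncated_cone_def\<close>)
  ultimately have "filterlim (\<lambda>y. \<i> * complex_of_real y) (inf at_infinity (principal (truncated_cone \<alpha> \<beta>))) at_top"
    by (simp add: filterlim_inf filterlim_principal)
  moreover have "((\<lambda>z. \<Phi> z / z) \<longlongrightarrow> 1) (inf at_infinity (principal (truncated_cone \<alpha> \<beta>)))"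
    using assms by (simp add: is_right_inverse_on_cone_def)
  ultimately show ?thesis by (rule filterlim_compose[rotated])
qed

context real_distribution
begin

text \<open>On the imaginary axis both inverses take values within y / 2 of iy for large y. Such
  points lie in the wide cone, where F is injective.\<close>

lemma right_inverse_unique:
  assumes inv: "is_right_inverse_on_cone M \<alpha>1 \<beta>1 \<Phi>1" "is_right_inverse_on_cone M \<alpha>2 \<beta>2 \<Phi>2"
    and "\<alpha>1 > 0" "\<alpha>2 > 0"
  shows "\<forall>\<^sub>F y in at_top. \<Phi>1 (\<i> * of_real y) = \<Phi>2 (\<i> * of_real y)"
proof -
  have "\<exists>\<beta>>0. \<forall>w. Im w > \<beta> \<longrightarrow> \<bar>Re w\<bar> \<le> 2 * Im w \<longrightarrow> cmod (recip_cauchy_transform M w - w) \<le> 1 / 2 * Im w"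
    by (rule cone_small) simp
  then obtain \<beta> where \<beta>: "\<beta> > 0"
    "\<And>w. Im w > \<beta> \<Longrightarrow> \<bar>Re w\<bar> \<le> 2 * Im w \<Longrightarrow> cmod (recip_cauchy_transform M w - w) \<le> 1 / 2 * Im w"
    by blast
  have near: "\<forall>\<^sub>F y in at_top. Im (\<Phi> (\<i> * of_real y)) > \<beta> \<and> \<bar>Re (\<Phi> (\<i> * of_real y))\<bar> \<le> 2 * Im (\<Phi> (\<i> * of_real y))
      \<and> recip_cauchy_transform M (\<Phi> (\<i> * of_real y)) = \<i> * of_real y"
    if inv: "is_right_inverse_on_cone M \<alpha> \<gamma> \<Phi>" and "\<alpha> > 0" for \<Phi> \<alpha> \<gamma>
  proof -
    have "\<forall>\<^sub>F y in at_top. dist (\<Phi> (\<i> * of_real y) / (\<i> * of_real y)) 1 < 1 / 2"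
      by (rule tendstoD[OF right_inverse_vertical_limit[OF that]]) simp
    with eventually_gt_at_top[of "2 * \<beta>"] eventually_gt_at_top[of \<gamma>] show ?thesis
    proof eventually_elim
      case (elim y)
      have "y > 0" using elim \<open>\<beta> > 0\<close> by simp
      let ?w = "\<Phi> (\<i> * of_real y)"
      have "?w / (\<i> * of_real y) - 1 = (?w - \<i> * of_real y) / (\<i> * of_real y)"
        using \<open>y > 0\<close> by (simp add: diff_divide_distrib)
      then have "cmod (?w - \<i> * of_real y) < y / 2"
        using elim(3) \<open>y > 0\<close> by (simp add: dist_norm norm_divide norm_mult divide_less_eq)
      then have "\<bar>Re ?w\<bar> < y / 2" "\<bar>Im ?w - y\<bar> < y / 2"
        using abs_Re_le_cmod[of "?w - \<i> * of_real y"] abs_Im_le_cmod[of "?w - \<i> * of_real y"] by auto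
      then have "Im ?w > \<beta>" "\<bar>Re ?w\<bar> \<le> 2 * Im ?w" using elim(1) by linarith+
      moreover have "\<i> * of_real y \<in> truncated_cone \<alpha> \<gamma>"
        using elim \<open>y > 0\<close> \<open>\<alpha> > 0\<close> by (simp add: truncated_cone_def)
      ultimately show ?case
        using inv by (auto simp: is_right_inverse_on_cone_def)
    qed
  qed
  show ?thesis
    using near[OF inv(1) \<open>\<alpha>1 > 0\<close>] near[OF inv(2) \<open>\<alpha>2 > 0\<close>]
  proof eventually_elim
    case (elim y)
    show ?case
      by (rule perturbed_injective[of \<beta> "1 / 2"]) (use elim \<beta> in auto)
  qed
qed

end

lemma recip_cauchy_transform_unique:
  assumes "real_distribution M" "real_distribution N"
    and "\<And>z. Im z > 0 \<Longrightarrow> recip_cauchy_transform M z = recip_cauchy_transform N z"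
  shows "M = N"
  using assms by (intro cauchy_transform_unique) (simp_all add: recip_cauchy_transform_def)

text \<open>High on the imaginary axis the two inverses for M agree, hence so do those for N1 and
  N2. Both reciprocal transforms then invert the same curve, and the identity theorem makes them
  equal on the whole half-plane.\<close>

lemma free_power_unique:
  assumes M: "real_distribution M" and N1: "real_distribution N1" and N2: "real_distribution N2"
    and "\<alpha>1 > 0" "\<beta>1 > 0" "\<alpha>2 > 0" "\<beta>2 > 0"
    and V1: "is_voiculescu_transform_on_cone M \<alpha>1 \<beta>1 V1" "is_voiculescu_transform_on_cone N1 \<alpha>1 \<beta>1 (\<lambda>z. of_real t * V1 z)"
    and V2: "is_voiculescu_transform_on_cone M \<alpha>2 \<beta>2 V2" "is_voiculescu_transform_on_cone N2 \<alpha>2 \<beta>2 (\<lambda>z. of_real t * V2 z)"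
  shows "N1 = N2"
proof -
  interpret M: real_distribution M by fact
  interpret N1: real_distribution N1 by fact
  interpret N2: real_distribution N2 by fact
  obtain \<Phi>1 where \<Phi>1: "is_right_inverse_on_cone M \<alpha>1 \<beta>1 \<Phi>1" "\<And>z. z \<in> truncated_cone \<alpha>1 \<beta>1 \<Longrightarrow> V1 z = \<Phi>1 z - z"
    using V1(1) by (auto simp: is_voiculescu_transform_on_cone_def)
  obtain \<Phi>2 where \<Phi>2: "is_right_inverse_on_cone M \<alpha>2 \<beta>2 \<Phi>2" "\<And>z. z \<in> truncated_cone \<alpha>2 \<beta>2 \<Longrightarrow> V2 z = \<Phi>2 z - z"
    using V2(1) by (auto simp: is_voiculescu_transform_on_cone_def)
  obtain \<Psi>1 where \<Psi>1: "is_right_inverse_on_cone N1 \<alpha>1 \<beta>1 \<Psi>1" "\<And>z. z \<in> truncated_cone \<alpha>1 \<beta>1 \<Longrightarrow> of_real t * V1 z = \<Psi>1 z - z"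
    using V1(2) by (auto simp: is_voiculescu_transform_on_cone_def)
  obtain \<Psi>2 where \<Psi>2: "is_right_inverse_on_cone N2 \<alpha>2 \<beta>2 \<Psi>2" "\<And>z. z \<in> truncated_cone \<alpha>2 \<beta>2 \<Longrightarrow> of_real t * V2 z = \<Psi>2 z - z"
    using V2(2) by (auto simp: is_voiculescu_transform_on_cone_def)
  obtain Y where Y: "\<And>y. y \<ge> Y \<Longrightarrow> \<Phi>1 (\<i> * of_real y) = \<Phi>2 (\<i> * of_real y)"
    using M.right_inverse_unique[OF \<Phi>1(1) \<Phi>2(1)] assms by (auto simp: eventually_at_top_linorder)
  define Y' where "Y' = max Y (max \<beta>1 \<beta>2)"
  have cones: "\<i> * of_real y \<in> truncated_cone \<alpha>1 \<beta>1" "\<i> * of_real y \<in> truncated_cone \<alpha>2 \<beta>2" if "y > Y'" for y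
    using that assms by (auto simp: truncated_cone_def Y'_def)
  have \<Psi>_eq: "\<Psi>1 (\<i> * of_real y) = \<Psi>2 (\<i> * of_real y)" if "y > Y'" for y
  proof -
    have "y \<ge> Y" using that by (simp add: Y'_def)
    then have "\<Psi>1 (\<i> * of_real y) - \<i> * of_real y = \<Psi>2 (\<i> * of_real y) - \<i> * of_real y"
      using \<Phi>1(2) \<Phi>2(2) \<Psi>1(2) \<Psi>2(2) cones[OF that] Y by metis
    then show ?thesis by simp
  qed
  have pos: "Im (\<Psi>1 (\<i> * of_real y)) > 0" and F1: "recip_cauchy_transform N1 (\<Psi>1 (\<i> * of_real y)) = \<i> * of_real y"
    and F2: "recip_cauchy_transform N2 (\<Psi>1 (\<i> * of_real y)) = \<i> * of_real y" if "y > Y'" for y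
    using \<Psi>1(1) \<Psi>2(1) cones[OF that] \<Psi>_eq[OF that] by (auto simp: is_right_inverse_on_cone_def)
  define U where "U = (\<lambda>y. \<Psi>1 (\<i> * of_real y)) ` {Y'<..}"
  \<comment> \<open>An accumulation point of the curve: \<open>\<Psi>1\<close> is continuous there,
    and nearby parameters give different points because the transform of N1 recovers the
    parameter.\<close>
  define \<xi> where "\<xi> = \<Psi>1 (\<i> * of_real (Y' + 1))"
  have "\<xi> islimpt U"
    unfolding islimpt_sequential
  proof (intro exI conjI allI)
    define s where "s = (\<lambda>n. \<Psi>1 (\<i> * of_real (Y' + 1 + 1 / real (Suc n))))"
    have gt: "Y' + 1 + 1 / real (Suc n) > Y'" for n
      by (rule less_trans[of _ "Y' + 1"]) auto
    have "s n \<noteq> \<xi>" for n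
    proof
      assume "s n = \<xi>"
      then have "\<i> * complex_of_real (Y' + 1 + 1 / real (Suc n)) = \<i> * complex_of_real (Y' + 1)"
        using F1[OF gt[of n]] F1[of "Y' + 1"] by (simp add: s_def \<xi>_def)
      then have "Y' + 1 + 1 / real (Suc n) = Y' + 1"
        by (simp only: mult_cancel_left of_real_eq_iff) simp
      then show False by simp
    qed
    moreover have "s n \<in> U" for n
      unfolding s_def U_def by (rule imageI) (simp only: greaterThan_iff gt)
    ultimately show "s n \<in> U - {\<xi>}" for n
      by blast
    have "isCont \<Psi>1 (\<i> * of_real (Y' + 1))"
    proof -
      have "\<Psi>1 analytic_on truncated_cone \<alpha>1 \<beta>1"
        using \<Psi>1(1) by (simp add: is_right_inverse_on_cone_def)
      then have "\<Psi>1 analytic_on {\<i> * of_real (Y' + 1)}"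
        by (rule analytic_on_subset) (use cones[of "Y' + 1"] in simp)
      then show ?thesis by (rule analytic_at_imp_isCont)
    qed
    moreover have "(\<lambda>n. \<i> * complex_of_real (Y' + 1 + 1 / real (Suc n))) \<longlonglongrightarrow> \<i> * complex_of_real (Y' + 1 + 0)"
      by (intro tendsto_intros LIMSEQ_Suc[OF lim_1_over_n])
    ultimately show "s \<longlonglongrightarrow> \<xi>"
      unfolding s_def \<xi>_def by (intro isCont_tendsto_compose[of _ \<Psi>1]) auto
  qed
  moreover have "(\<lambda>z. recip_cauchy_transform N1 z - recip_cauchy_transform N2 z) holomorphic_on upper_half_plane"
    by (intro holomorphic_intros N1.recip_cauchy_transform_holomorphic N2.recip_cauchy_transform_holomorphic)
  moreover have "U \<subseteq> upper_half_plane"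
    using pos by (auto simp: U_def)
  moreover have "\<xi> \<in> upper_half_plane"
    using pos[of "Y' + 1"] by (simp add: \<xi>_def)
  moreover have "recip_cauchy_transform N1 z - recip_cauchy_transform N2 z = 0" if "z \<in> U" for z
    using that F1 F2 by (auto simp: U_def)
  ultimately have "recip_cauchy_transform N1 z - recip_cauchy_transform N2 z = 0" if "z \<in> upper_half_plane" for z
    using analytic_continuation[OF _ open_upper_half_plane convex_connected[OF convex_upper_half_plane]] that
    by meson
  then show ?thesis
    by (intro recip_cauchy_transform_unique N1 N2) simp
qed

context real_distribution
begin

lemma recip_cauchy_transform_subordination:
  assumes "t > 0" "Im z > 0"
  shows "recip_cauchy_transform M (subordination t z)
    = z + of_real (1 + t) * (recip_cauchy_transform M (subordination t z) - subordination t z)"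
    (is "?F = z + of_real (1 + t) * (?F - ?w)")
proof -
  have "?F = z + (?w - z) + (?F - ?w)" by simp
  also have "?w - z = of_real t * (?F - ?w)"
    by (rule subordination_increment[OF assms])
  also have "z + of_real t * (?F - ?w) + (?F - ?w) = z + of_real (1 + t) * (?F - ?w)"
    by (simp add: algebra_simps)
  finally show ?thesis .
qed

text \<open>The measure with \<open>F(z) - z\<close> equal to (1 + t)
  g(\<open>subordination t z\<close>) is the candidate; its transform is F composed with
  \<open>subordination t\<close>. On the cone, \<open>\<Psi> = \<Phi> - t g(\<Phi>)\<close> is sent
  back to \<open>\<Phi>\<close> by subordination, so F then returns z.\<close>

lemma free_power_exists:
  assumes t: "t > 0"
  obtains \<nu> where "real_distribution \<nu>"
    "\<And>z. Im z > 0 \<Longrightarrow> recip_cauchy_transform \<nu> z = recip_cauchy_transform M (subordination t z)"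
    "\<exists>\<alpha>>0. \<exists>\<beta>>0. \<exists>V. is_voiculescu_transform_on_cone M \<alpha> \<beta> V \<and>
        is_voiculescu_transform_on_cone \<nu> \<alpha> \<beta> (\<lambda>z. of_real (1 + t) * V z)"
proof -
  define g where "g = (\<lambda>z. recip_cauchy_transform M z - z)"
  interpret P: pick_perturbation "\<lambda>z. of_real (1 + t) * g (subordination t z)"
    unfolding g_def using t by (intro pick_perturbation_subordinated) auto
  obtain \<nu> where \<nu>: "real_distribution \<nu>"
    and F\<nu>: "\<And>z. Im z > 0 \<Longrightarrow> recip_cauchy_transform \<nu> z = z + of_real (1 + t) * g (subordination t z)"
    using P.representing_measure_exists by blast
  have F_sub: "recip_cauchy_transform \<nu> z = recip_cauchy_transform M (subordination t z)" if "Im z > 0" for z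
    using F\<nu>[OF that] recip_cauchy_transform_subordination[OF t that] unfolding g_def by (rule trans[OF _ sym])
  obtain \<Phi> \<beta> where \<beta>: "\<beta> > 0" and hol: "\<Phi> holomorphic_on truncated_cone 1 \<beta>"
    and \<Phi>: "\<And>z. z \<in> truncated_cone 1 \<beta> \<Longrightarrow> Im (\<Phi> z) > 0 \<and> \<Phi> z + g (\<Phi> z) = z \<and> Im (\<Phi> z - of_real t * g (\<Phi> z)) > 0"
    and lim: "((\<lambda>z. \<Phi> z / z) \<longlongrightarrow> 1) (inf at_infinity (principal (truncated_cone 1 \<beta>)))"
    unfolding g_def by (rule cone_inverse_exists[OF less_imp_le[OF t]]) blast
  have "open (truncated_cone 1 \<beta>)"
  proof -
    have "truncated_cone 1 \<beta> = {z. 0 < Im z \<and> \<bar>Re z\<bar> < Im z \<and> \<beta> < Im z}"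
      by (auto simp: truncated_cone_def)
    then show ?thesis
      by (auto intro!: open_Collect_conj open_Collect_less continuous_intros)
  qed
  have inv_M: "is_right_inverse_on_cone M 1 \<beta> \<Phi>"
    unfolding is_right_inverse_on_cone_def
    using hol \<open>open _\<close> \<Phi> lim by (auto simp: analytic_on_open g_def)
  \<comment> \<open>Chosen so that \<open>\<Psi> z - z\<close> is 1 + t times the Voiculescu
    transform of M.\<close>
  define \<Psi> where "\<Psi> = (\<lambda>z. z + of_real (1 + t) * (\<Phi> z - z))"
  have \<Psi>_eq: "\<Psi> z = \<Phi> z - of_real t * g (\<Phi> z)" if "z \<in> truncated_cone 1 \<beta>" for z
  proof -
    have *: "g (\<Phi> z) = z - \<Phi> z" using \<Phi>[OF that] by (metis add_diff_cancel_left')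
    show ?thesis unfolding \<Psi>_def * by (simp add: algebra_simps)
  qed
  have "is_right_inverse_on_cone \<nu> 1 \<beta> \<Psi>"
    unfolding is_right_inverse_on_cone_def
  proof (intro conjI ballI)
    have "\<Psi> holomorphic_on truncated_cone 1 \<beta>"
      unfolding \<Psi>_def by (intro holomorphic_intros hol)
    then show "\<Psi> analytic_on truncated_cone 1 \<beta>"
      using \<open>open _\<close> by (simp add: analytic_on_open)
    fix z assume z: "z \<in> truncated_cone 1 \<beta>"
    have pos: "Im (\<Psi> z) > 0" using \<Phi>[OF z] \<Psi>_eq[OF z] by metis
    then show "\<Psi> z \<in> upper_half_plane" by simp
    have "subordination t (\<Psi> z) = \<Phi> z"
      using \<Phi>[OF z] \<Psi>_eq[OF z] pos unfolding g_def by (intro subordination_eqI t) auto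
    then show "recip_cauchy_transform \<nu> (\<Psi> z) = z"
      using F_sub[OF pos] \<Phi>[OF z] by (simp add: g_def)
  next
    have "((\<lambda>z. 1 + of_real (1 + t) * (\<Phi> z / z - 1)) \<longlongrightarrow> 1 + of_real (1 + t) * (1 - 1)) (inf at_infinity (principal (truncated_cone 1 \<beta>)))"
      by (intro tendsto_intros lim)
    then have "((\<lambda>z. 1 + of_real (1 + t) * (\<Phi> z / z - 1)) \<longlongrightarrow> 1) (inf at_infinity (principal (truncated_cone 1 \<beta>)))"
      by simp
    moreover have "\<forall>\<^sub>F z in inf at_infinity (principal (truncated_cone 1 \<beta>)). 1 + of_real (1 + t) * (\<Phi> z / z - 1) = \<Psi> z / z"
      unfolding eventually_inf_principal
    proof (intro always_eventually allI impI)
      fix z assume "z \<in> truncated_cone 1 \<beta>"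
      then have "z \<noteq> 0" by (auto simp: truncated_cone_def)
      then show "1 + of_real (1 + t) * (\<Phi> z / z - 1) = \<Psi> z / z"
        by (simp add: \<Psi>_def field_simps)
    qed
    ultimately show "((\<lambda>z. \<Psi> z / z) \<longlongrightarrow> 1) (inf at_infinity (principal (truncated_cone 1 \<beta>)))"
      by (rule Lim_transform_eventually)
  qed
  then have "is_voiculescu_transform_on_cone \<nu> 1 \<beta> (\<lambda>z. of_real (1 + t) * (\<Phi> z - z))"
    unfolding is_voiculescu_transform_on_cone_def by (intro exI[of _ \<Psi>]) (simp add: \<Psi>_def)
  moreover have "is_voiculescu_transform_on_cone M 1 \<beta> (\<lambda>z. \<Phi> z - z)"
    unfolding is_voiculescu_transform_on_cone_def using inv_M by blast
  ultimately show ?thesis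
    using that[OF \<nu> F_sub] \<beta> zero_less_one by blast
qed

lemma
  assumes t: "t > 0"
  shows real_distribution_free_power: "real_distribution (free_power M (1 + t))"
    and recip_cauchy_transform_free_power:
      "Im z > 0 \<Longrightarrow> recip_cauchy_transform (free_power M (1 + t)) z = recip_cauchy_transform M (subordination t z)"
proof -
  obtain \<nu> where \<nu>: "real_distribution \<nu>"
    "\<And>z. Im z > 0 \<Longrightarrow> recip_cauchy_transform \<nu> z = recip_cauchy_transform M (subordination t z)"
    "\<exists>\<alpha>>0. \<exists>\<beta>>0. \<exists>V. is_voiculescu_transform_on_cone M \<alpha> \<beta> V \<and>
        is_voiculescu_transform_on_cone \<nu> \<alpha> \<beta> (\<lambda>z. of_real (1 + t) * V z)"
    by (rule free_power_exists[OF t]) blast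
  have "free_power M (1 + t) = \<nu>"
    unfolding free_power_def
  proof (rule the_equality)
    fix \<nu>' assume "real_distribution \<nu>' \<and> (\<exists>\<alpha>>0. \<exists>\<beta>>0. \<exists>V. is_voiculescu_transform_on_cone M \<alpha> \<beta> V \<and>
        is_voiculescu_transform_on_cone \<nu>' \<alpha> \<beta> (\<lambda>z. of_real (1 + t) * V z))"
    then show "\<nu>' = \<nu>"
      using \<nu>(1,3) free_power_unique[OF real_distribution_axioms, of \<nu>' \<nu>] by blast
  qed (use \<nu> in blast)
  then show "real_distribution (free_power M (1 + t))"
    "Im z > 0 \<Longrightarrow> recip_cauchy_transform (free_power M (1 + t)) z = recip_cauchy_transform M (subordination t z)"
    using \<nu> by auto
qed

text \<open>The free power has transform z + (1 + t) g(w) with w the value of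
  \<open>subordination t z\<close>; Boolean averaging with weight 1 / (1 + t) cancels the factor 1 +
  t and leaves z + g(w).\<close>

theorem recip_cauchy_transform_free_boolean_map:
  assumes t: "t > 0" and z: "Im z > 0"
  shows "recip_cauchy_transform (free_boolean_map t M) z - z
    = recip_cauchy_transform M (subordination t z) - subordination t z"
proof -
  define g where "g = (\<lambda>z. recip_cauchy_transform M z - z)"
  interpret P: pick_perturbation "\<lambda>z. of_real 1 * g (subordination t z)"
    unfolding g_def using t by (intro pick_perturbation_subordinated) auto
  obtain \<nu> where \<nu>: "real_distribution \<nu>"
    and F\<nu>: "\<And>z. Im z > 0 \<Longrightarrow> recip_cauchy_transform \<nu> z = z + of_real 1 * g (subordination t z)"
    using P.representing_measure_exists by blast
  have eq: "of_real (1 / (1 + t)) * recip_cauchy_transform (free_power M (1 + t)) z + of_real (1 - 1 / (1 + t)) * z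
      = z + of_real 1 * g (subordination t z)" if z: "Im z > 0" for z
  proof -
    let ?w = "subordination t z" and ?c = "complex_of_real (1 / (1 + t))"
    have "recip_cauchy_transform M ?w = z + of_real (1 + t) * g ?w"
      unfolding g_def by (rule recip_cauchy_transform_subordination[OF t z])
    moreover have "?c * of_real (1 + t) = 1"
      using t by (simp add: of_real_mult[symmetric] del: of_real_mult of_real_add of_real_divide)
    ultimately have "?c * recip_cauchy_transform M ?w = ?c * z + g ?w"
      by (simp only: distrib_left mult.assoc[symmetric]) simp
    then show ?thesis
      by (simp add: recip_cauchy_transform_free_power[OF t z] left_diff_distrib)
  qed
  have "free_boolean_map t M = \<nu>"
    unfolding free_boolean_map_def boolean_power_def
  proof (rule the_equality)
    show "real_distribution \<nu> \<and> (\<forall>z\<in>upper_half_plane. recip_cauchy_transform \<nu> z =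
        of_real (1 / (1 + t)) * recip_cauchy_transform (free_power M (1 + t)) z + of_real (1 - 1 / (1 + t)) * z)"
      using \<nu> F\<nu> eq by simp
    show "\<nu>' = \<nu>" if "real_distribution \<nu>' \<and> (\<forall>z\<in>upper_half_plane. recip_cauchy_transform \<nu>' z =
        of_real (1 / (1 + t)) * recip_cauchy_transform (free_power M (1 + t)) z + of_real (1 - 1 / (1 + t)) * z)" for \<nu>'
      using that \<nu> F\<nu> eq by (intro recip_cauchy_transform_unique) auto
  qed
  then show ?thesis
    using F\<nu>[OF z] by (simp add: g_def)
qed

end

theorem theorem3:
  fixes \<mu> :: "real measure"
    and h :: "real \<Rightarrow> complex \<Rightarrow> complex"
  assumes "real_distribution \<mu>"
    and "\<And>t z. t > 0 \<Longrightarrow> z \<in> upper_half_plane \<Longrightarrow>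
           h t z = recip_cauchy_transform (free_boolean_map t \<mu>) z - z"
  shows "\<forall>t>0. \<forall>z\<in>upper_half_plane.
           h t field_differentiable (at z) \<and>
           ((\<lambda>s. h s z) has_vector_derivative h t z * deriv (h t) z) (at t)"
proof (intro allI impI ballI)
  interpret real_distribution \<mu> by fact
  fix t :: real and z assume t: "t > 0" and z: "z \<in> upper_half_plane"
  \<comment> \<open>The function h is prescribed only for positive times on the half-plane. Both
    sets are open, so h and k agree near the given point and have the same derivatives
    there.\<close>
  define k where "k = (\<lambda>s z. recip_cauchy_transform \<mu> (subordination s z) - subordination s z)"
  have h_eq: "h s w = k s w" if "s > 0" "w \<in> upper_half_plane" for s w
    using assms(2)[OF that] recip_cauchy_transform_free_boolean_map that by (simp add: k_def)
  have k: "k t field_differentiable (at z)" "((\<lambda>s. k s z) has_vector_derivative k t z * deriv (k t) z) (at t)"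
    using subordinated_Burgers[OF t, of z] z by (simp_all add: k_def)
  have near_z: "\<forall>\<^sub>F w in nhds z. h t w = k t w"
    using eventually_nhds_in_open[OF open_upper_half_plane z] by eventually_elim (rule h_eq[OF t])
  then have "deriv (h t) z = deriv (k t) z"
    by (rule deriv_cong_ev) simp
  moreover have "h t field_differentiable (at z)"
    using k(1) near_z unfolding field_differentiable_def
    by (metis DERIV_cong_ev)
  moreover have "\<forall>\<^sub>F s in nhds t. h s z = k s z"
    using eventually_nhds_in_open[of "{0<..}" t] t
    by (auto elim!: eventually_mono intro: h_eq[OF _ z])
  then have "((\<lambda>s. h s z) has_vector_derivative k t z * deriv (k t) z) (at t)"
    using k(2) has_vector_derivative_cong_ev[where x = t and S = UNIV and f = "\<lambda>s. h s z" and g = "\<lambda>s. k s z"] h_eq[OF t z]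
    by simp
  ultimately show "h t field_differentiable (at z) \<and>
      ((\<lambda>s. h s z) has_vector_derivative h t z * deriv (h t) z) (at t)"
    by (simp add: h_eq[OF t z])
qed


end
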